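(* $FC(6,8) = 26$.
   Context: All families are finite families of finite sets. A family $\mathcal{F}$ is union-closed if $A\cup B\in\mathcal{F}$ for all $A,B\in\mathcal{F}$. For a family $\mathcal{F}$, write $U(\mathcal{F})=\bigcup_{S\in\mathcal{F}}S$ for its ground set (universe) and $\mathcal{F}_i=\{S\in\mathcal{F}: i\in S\}$. A family $\mathcal{A}$ is Frankl-Complete (FC) if for every union-closed family $\mathcal{F}\supseteq\mathcal{A}$ there is some $i\in U(\mathcal{A})$ with $|\mathcal{F}_i|\ge|\mathcal{F}|/2$. Write $[n]=\{1,\dots,n\}$ and $\mathcal{P}([n])$ for its power set; a $k$-set is a set with exactly $k$ elements. For $3\le k<n$, $FC(k,n)$ is the least integer $m$ such that every family $\mathcal{A}\subseteq\mathcal{P}([n])$ containing $m$ distinct $k$-sets is FC. (It is regarded as undefined if even the family of all $k$-subsets of $[n]$ is not FC.) *)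

theory Defs
  imports Complex_Main
begin

definition finite_family :: "'a set set \<Rightarrow> bool" where
  "finite_family F \<longleftrightarrow> finite F \<and> (\<forall>S\<in>F. finite S)"

definition union_closed :: "'a set set \<Rightarrow> bool" where
  "union_closed F \<longleftrightarrow> (\<forall>A\<in>F. \<forall>B\<in>F. A \<union> B \<in> F)"

definition members_with :: "'a set set \<Rightarrow> 'a \<Rightarrow> 'a set set" where
  "members_with F i = {S \<in> F. i \<in> S}"

text \<open>
  The families \<open>F\<close> may contain elements outside \<open>\<Union>A\<close>, without any bound on how many.
  Taking the elements from the infinite type \<open>nat\<close> is no restriction, since the universe
  of a finite family of finite sets is finite.
\<close>

definition frankl_complete :: "nat set set \<Rightarrow> bool" where
  "frankl_complete A \<longleftrightarrow>
     (\<forall>F. finite_family F \<and> union_closed F \<and> A \<subseteq> F \<longrightarrow>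
        (\<exists>i\<in>\<Union>A. real (card (members_with F i)) \<ge> real (card F) / 2))"

text \<open>
  A family containing \<open>m\<close> distinct \<open>k\<close>-sets contains at least that many, and may also
  contain sets of other sizes.
\<close>

definition FC_threshold :: "nat \<Rightarrow> nat \<Rightarrow> nat \<Rightarrow> bool" where
  "FC_threshold k n m \<longleftrightarrow>
     (\<forall>A. A \<subseteq> Pow {1..n} \<and> m \<le> card {S \<in> A. card S = k} \<longrightarrow> frankl_complete A)"

text \<open>
  The value \<open>None\<close> means undefined. The test on the family of all \<open>k\<close>-subsets is needed because
  every \<open>m > n choose k\<close> is vacuously a threshold.
\<close>

definition FC :: "nat \<Rightarrow> nat \<Rightarrow> nat option" where
  "FC k n =
     (if 3 \<le> k \<and> k < n \<and> frankl_complete {S. S \<subseteq> {1..n} \<and> card S = k}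
      then Some (LEAST m. FC_threshold k n m) else None)"

end

theory Submission
  imports Defs "HOL-Combinatorics.Permutations"
begin

text \<open>
  Upper bound. At most two 6-sets are missing, namely the complements of two 2-sets \<open>e\<close> and \<open>f\<close>.
  Splitting \<open>F\<close> by the trace outside \<open>[8]\<close>, it suffices to find positive weights \<open>c\<close> with
  \<open>c([8])/2 * |B| \<le> (\<Sum>S\<in>B. c(S))\<close> for every union-closed \<open>B \<subseteq> P([8])\<close> that absorbs the members of
  \<open>A\<close>. Averaging over the permutations preserving three blocks (\<open>e\<close>, \<open>f\<close> and the rest if \<open>e\<close> and \<open>f\<close>
  are disjoint; \<open>e \<inter> f\<close>, the other two points of \<open>e \<union> f\<close>, and the rest otherwise) replaces \<open>B\<close> by
  a function \<open>\<phi>\<close> of the three block intersection sizes. If \<open>Z \<supseteq> X \<union> Y\<close> is absorbed by \<open>B\<close>, then \<open>Z\<close>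
  lies in \<open>B\<close> as soon as \<open>X\<close> or \<open>Y\<close> does, which gives
  \<open>\<phi>(X) + \<phi>(Y) \<le> \<phi>(X \<union> Y) + \<phi>(Z)\<close>. The weighted inequality is a nonnegative linear combination
  of inequalities of this form.

  Lower bound. Remove the complements of the matching \<open>12, 34, 56\<close> and let \<open>U\<close> be the remaining
  sets of size at least 6. The family \<open>P([8] - {i}) \<union> U\<close> is closed under unions with \<open>U\<close> and makes
  \<open>i\<close> very rare, at the expense of making the other elements slightly frequent. Attaching
  many such families, with suitable multiplicities for the \<open>i\<close>, to the sets \<open>X - {x}\<close>, \<open>x \<in> X\<close>, for
  a set \<open>X\<close> of new elements makes all elements of \<open>[8]\<close> rare simultaneously.
\<close>

section \<open>Averaging over block permutations\<close>

lemma ex_permutes_image_eq: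
  assumes "finite P" "S \<subseteq> P" "S' \<subseteq> P" "card S = card S'"
  shows "\<exists>p. p permutes P \<and> p ` S = S'"
proof -
  have fin: "finite S" "finite S'" using assms finite_subset by auto
  obtain f where f: "bij_betw f S S'"
    using assms(4) fin finite_same_card_bij by blast
  have "card (P - S) = card (P - S')"
    using assms fin by (simp add: card_Diff_subset)
  then obtain g where g: "bij_betw g (P - S) (P - S')"
    using assms(1) finite_same_card_bij by (metis finite_Diff)
  define p where "p x = (if x \<in> S then f x else if x \<in> P then g x else x)" for x
  have 1: "bij_betw p S S'"
    using f by (rule bij_betw_cong[THEN iffD1, rotated]) (simp add: p_def)
  have 2: "bij_betw p (P - S) (P - S')"
    using g by (rule bij_betw_cong[THEN iffD1, rotated]) (simp add: p_def)
  have "bij_betw p (S \<union> (P - S)) (S' \<union> (P - S'))"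
    using 1 2 by (rule bij_betw_combine) auto
  then have "bij_betw p P P"
    using assms(2,3) by (simp add: Un_absorb1)
  then have "p permutes P"
    using assms(2) by (intro bij_imp_permutes) (auto simp: p_def)
  with 1 show ?thesis by (auto simp: bij_betw_def)
qed

text \<open>After numbering \<open>P\<close>, \<open>X\<close> is the initial segment of length
  \<open>x\<close>, \<open>Y\<close> consists of the last \<open>y\<close> points of the initial
  segment of length \<open>t\<close>, and \<open>Z\<close> is the initial segment of length
  \<open>z\<close>. The bound \<open>t \<le> x + y\<close> leaves no gap between \<open>X\<close>
  and \<open>Y\<close>.\<close>

lemma ex_sets_card_union:
  assumes "finite P" "x \<le> t" "y \<le> t" "t \<le> x + y" "t \<le> z" "z \<le> card P"
  shows "\<exists>X Y Z. X \<subseteq> P \<and> Y \<subseteq> P \<and> Z \<subseteq> P \<and> X \<union> Y \<subseteq> Z \<and>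
           card X = x \<and> card Y = y \<and> card (X \<union> Y) = t \<and> card Z = z"
proof -
  obtain h where h: "bij_betw h {..<card P} P"
    using ex_bij_betw_nat_finite[OF assms(1)] by (auto simp: atLeast0LessThan)
  have card_h: "card (h ` N) = card N" if "N \<subseteq> {..<card P}" for N
    using h that by (meson bij_betw_def card_image inj_on_subset)
  have sub_h: "h ` N \<subseteq> P" if "N \<subseteq> {..<card P}" for N
    using h that by (auto simp: bij_betw_def)
  have un: "{..<x} \<union> {t - y..<t} = {..<t}" using assms by auto
  have le: "{..<x} \<subseteq> {..<card P}" "{t - y..<t} \<subseteq> {..<card P}" "{..<z} \<subseteq> {..<card P}"
    "{..<t} \<subseteq> {..<card P}"
    using assms by auto
  show ?thesis
  proof (intro exI conjI)
    show "h ` {..<x} \<union> h ` {t - y..<t} \<subseteq> h ` {..<z}"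
      unfolding image_Un[symmetric] un using assms by (intro image_mono) auto
    show "card (h ` {..<x} \<union> h ` {t - y..<t}) = t"
      unfolding image_Un[symmetric] un using card_h[OF le(4)] by simp
  qed (use card_h[OF le(1)] card_h[OF le(2)] card_h[OF le(3)] sub_h le assms in auto)
qed

section \<open>The group of block permutations and its orbits on subsets\<close>

locale three_blocks =
  fixes P Q R :: "'a set"
  assumes fin: "finite P" "finite Q" "finite R"
    and disj: "P \<inter> Q = {}" "P \<inter> R = {}" "Q \<inter> R = {}"
begin

definition V :: "'a set" where "V = P \<union> Q \<union> R"

definition block_perms :: "('a \<Rightarrow> 'a) set" where
  "block_perms = {p. p permutes V \<and> p ` P = P \<and> p ` Q = Q \<and> p ` R = R}"

definition profile :: "'a set \<Rightarrow> nat \<times> nat \<times> nat" where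
  "profile S = (card (S \<inter> P), card (S \<inter> Q), card (S \<inter> R))"

text \<open>Up to the factor \<open>card block_perms\<close>, this is the fraction of the orbit of
  \<open>S\<close> that lies in \<open>B\<close>. Counting permutations instead of orbit members
  gives every orbit the same normalisation, so inequalities can be proved one permutation at a
  time.\<close>

definition hits :: "'a set set \<Rightarrow> 'a set \<Rightarrow> real" where
  "hits B S = (\<Sum>p\<in>block_perms. of_bool (p ` S \<in> B))"

text \<open>By \<open>hits_cong\<close> the choice of the representative does not matter. Whatever
  set is chosen, the value is a count, hence nonnegative for every triple.\<close>

definition profile_hits :: "'a set set \<Rightarrow> nat \<times> nat \<times> nat \<Rightarrow> real" where
  "profile_hits B s = hits B (SOME S. S \<subseteq> V \<and> profile S = s)"

lemma finite_V: "finite V"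
  using fin by (simp add: V_def)

lemma finite_block_perms: "finite block_perms"
  by (rule finite_subset[OF _ finite_permutations[OF finite_V]]) (auto simp: block_perms_def)

lemma block_permsD:
  assumes "p \<in> block_perms"
  shows "p permutes V" "inj p" "p ` P = P" "p ` Q = Q" "p ` R = R"
  using assms permutes_inj by (auto simp: block_perms_def)

lemma id_block_perms: "id \<in> block_perms"
  by (simp add: block_perms_def permutes_id)

lemma comp_block_perms:
  assumes "p \<in> block_perms" "q \<in> block_perms"
  shows "p \<circ> q \<in> block_perms"
proof -
  have "(p \<circ> q) ` P = P" "(p \<circ> q) ` Q = Q" "(p \<circ> q) ` R = R"
    using block_permsD(3-5)[OF assms(1)] block_permsD(3-5)[OF assms(2)] by (metis image_comp)+
  with assms show ?thesis
    by (auto simp: block_perms_def intro: permutes_compose)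
qed

lemma inv_block_perms:
  assumes "p \<in> block_perms"
  shows "inv p \<in> block_perms"
proof -
  have "inv p ` P = P" "inv p ` Q = Q" "inv p ` R = R"
    using block_permsD[OF assms] by (metis image_inv_f_f)+
  with assms show ?thesis
    by (auto simp: block_perms_def intro: permutes_inv)
qed

lemma profile_image:
  assumes "p \<in> block_perms"
  shows "profile (p ` S) = profile S"
proof -
  note p = block_permsD[OF assms]
  have "card (p ` S \<inter> T) = card (S \<inter> T)" if "p ` T = T" for T
    using that card_image[OF inj_on_subset[OF p(2) subset_UNIV], of "S \<inter> T"]
    by (metis image_Int[OF p(2)])
  with p show ?thesis by (simp add: profile_def)
qed

text \<open>The profile is a complete invariant of the orbit: permutations chosen separately in each
  block have disjoint supports, so their composite acts on each block as the one chosen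
  there.\<close>

lemma ex_block_perm:
  assumes "S \<subseteq> V" "S' \<subseteq> V" "profile S = profile S'"
  shows "\<exists>p\<in>block_perms. p ` S = S'"
proof -
  have "\<exists>p. p permutes T \<and> p ` (S \<inter> T) = S' \<inter> T"
    if "finite T" "card (S \<inter> T) = card (S' \<inter> T)" for T
    using that by (intro ex_permutes_image_eq) auto
  then obtain p q r where
    p: "p permutes P" "p ` (S \<inter> P) = S' \<inter> P" and
    q: "q permutes Q" "q ` (S \<inter> Q) = S' \<inter> Q" and
    r: "r permutes R" "r ` (S \<inter> R) = S' \<inter> R"
    using fin assms(3) unfolding profile_def by (metis prod.inject)
  define h where "h = p \<circ> q \<circ> r"
  have "p x = x" if "x \<notin> P" for x using p(1) that by (simp add: permutes_not_in)
  moreover have "q x = x" if "x \<notin> Q" for x using q(1) that by (simp add: permutes_not_in)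
  moreover have "r x = x" if "x \<notin> R" for x using r(1) that by (simp add: permutes_not_in)
  moreover have "q x \<in> Q \<longleftrightarrow> x \<in> Q" "r x \<in> R \<longleftrightarrow> x \<in> R" for x
    using q(1) r(1) by (simp_all add: permutes_in_image)
  ultimately have on: "x \<in> P \<Longrightarrow> h x = p x" "x \<in> Q \<Longrightarrow> h x = q x" "x \<in> R \<Longrightarrow> h x = r x" for x
    using disj unfolding h_def o_def by (metis disjoint_iff)+
  have hP: "h ` (T \<inter> P) = p ` (T \<inter> P)" and hQ: "h ` (T \<inter> Q) = q ` (T \<inter> Q)"
    and hR: "h ` (T \<inter> R) = r ` (T \<inter> R)" for T
    using on by (auto intro!: image_cong)
  have "h permutes V"
    unfolding h_def V_def using p(1) q(1) r(1)
    by (intro permutes_compose) (auto intro: permutes_subset)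
  moreover have "h ` P = P" "h ` Q = Q" "h ` R = R"
    using hP[of UNIV] hQ[of UNIV] hR[of UNIV] p(1) q(1) r(1) by (simp_all add: permutes_image)
  moreover have "h ` S = S'"
  proof -
    have "S = (S \<inter> P) \<union> (S \<inter> Q) \<union> (S \<inter> R)" using assms(1) by (auto simp: V_def)
    then have "h ` S = h ` (S \<inter> P) \<union> h ` (S \<inter> Q) \<union> h ` (S \<inter> R)" by (metis image_Un)
    also have "\<dots> = S'" unfolding hP hQ hR p(2) q(2) r(2) using assms(2) by (auto simp: V_def)
    finally show ?thesis .
  qed
  ultimately show ?thesis by (auto simp: block_perms_def)
qed

lemma sum_block_perms_comp:
  assumes "q \<in> block_perms"
  shows "(\<Sum>p\<in>block_perms. f (p \<circ> q)) = (\<Sum>p\<in>block_perms. f p)"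
proof (rule sum.reindex_bij_witness[where j = "\<lambda>p. p \<circ> q" and i = "\<lambda>p. p \<circ> inv q"])
  fix p assume "p \<in> block_perms"
  show "p \<circ> q \<circ> inv q = p" "p \<circ> inv q \<circ> q = p"
    by (simp_all add: comp_assoc permutes_inv_o[OF block_permsD(1)[OF assms]])
qed (use assms comp_block_perms inv_block_perms in auto)

lemma hits_cong:
  assumes "S \<subseteq> V" "S' \<subseteq> V" "profile S = profile S'"
  shows "hits B S = hits B S'"
proof -
  obtain q where q: "q \<in> block_perms" "q ` S' = S"
    using ex_block_perm[of S' S] assms by auto
  have "hits B S = (\<Sum>p\<in>block_perms. of_bool ((p \<circ> q) ` S' \<in> B))"
    unfolding hits_def image_comp[symmetric] q(2) ..
  also have "\<dots> = hits B S'"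
    unfolding hits_def by (rule sum_block_perms_comp[OF q(1), of "\<lambda>p. of_bool (p ` S' \<in> B)"])
  finally show ?thesis .
qed

lemma hits_eq_profile_hits:
  assumes "S \<subseteq> V"
  shows "hits B S = profile_hits B (profile S)"
  unfolding profile_hits_def
  by (rule hits_cong[OF assms]) (use someI[of "\<lambda>T. T \<subseteq> V \<and> profile T = profile S" S] assms in auto)

lemma profile_hits_nonneg: "profile_hits B s \<ge> 0"
  unfolding profile_hits_def hits_def by (intro sum_nonneg) simp

lemma profile_Un_blocks:
  assumes "X \<subseteq> P" "Y \<subseteq> Q" "Z \<subseteq> R"
  shows "profile (X \<union> Y \<union> Z) = (card X, card Y, card Z)"
proof -
  have "(X \<union> Y \<union> Z) \<inter> P = X" "(X \<union> Y \<union> Z) \<inter> Q = Y" "(X \<union> Y \<union> Z) \<inter> R = Z"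
    using assms disj by auto
  then show ?thesis by (simp add: profile_def)
qed

text \<open>Choose \<open>X\<close>, \<open>Y\<close> and \<open>Z \<supseteq> X \<union> Y\<close>
  with the given profiles and compare indicators for each \<open>p\<close>: if the image of
  \<open>X\<close> or of \<open>Y\<close> lies in \<open>B\<close>, absorption puts the image of
  \<open>Z\<close> into \<open>B\<close>; if both do, so does the image of
  \<open>X \<union> Y\<close>. Absorption is assumed for a whole profile because \<open>p\<close>
  moves \<open>Z\<close> within it.\<close>

lemma profile_hits_ineq:
  assumes cl: "\<And>X Y. X \<in> B \<Longrightarrow> Y \<in> B \<Longrightarrow> X \<union> Y \<in> B"
    and absorb: "\<And>X Z. X \<in> B \<Longrightarrow> Z \<subseteq> V \<Longrightarrow> profile Z = (z1, z2, z3) \<Longrightarrow> X \<union> Z \<in> B"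
    and x1: "x1 \<le> t1" "y1 \<le> t1" "t1 \<le> x1 + y1" "t1 \<le> z1" "z1 \<le> card P"
    and x2: "x2 \<le> t2" "y2 \<le> t2" "t2 \<le> x2 + y2" "t2 \<le> z2" "z2 \<le> card Q"
    and x3: "x3 \<le> t3" "y3 \<le> t3" "t3 \<le> x3 + y3" "t3 \<le> z3" "z3 \<le> card R"
  shows "profile_hits B (x1, x2, x3) + profile_hits B (y1, y2, y3)
    \<le> profile_hits B (t1, t2, t3) + profile_hits B (z1, z2, z3)"
proof -
  obtain X1 Y1 Z1 where 1: "X1 \<subseteq> P" "Y1 \<subseteq> P" "Z1 \<subseteq> P" "X1 \<union> Y1 \<subseteq> Z1"
    "card X1 = x1" "card Y1 = y1" "card (X1 \<union> Y1) = t1" "card Z1 = z1"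
    using ex_sets_card_union[OF fin(1) x1] by blast
  obtain X2 Y2 Z2 where 2: "X2 \<subseteq> Q" "Y2 \<subseteq> Q" "Z2 \<subseteq> Q" "X2 \<union> Y2 \<subseteq> Z2"
    "card X2 = x2" "card Y2 = y2" "card (X2 \<union> Y2) = t2" "card Z2 = z2"
    using ex_sets_card_union[OF fin(2) x2] by blast
  obtain X3 Y3 Z3 where 3: "X3 \<subseteq> R" "Y3 \<subseteq> R" "Z3 \<subseteq> R" "X3 \<union> Y3 \<subseteq> Z3"
    "card X3 = x3" "card Y3 = y3" "card (X3 \<union> Y3) = t3" "card Z3 = z3"
    using ex_sets_card_union[OF fin(3) x3] by blast
  define X where "X = X1 \<union> X2 \<union> X3"
  define Y where "Y = Y1 \<union> Y2 \<union> Y3"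
  define Z where "Z = Z1 \<union> Z2 \<union> Z3"
  have XY: "X \<union> Y = (X1 \<union> Y1) \<union> (X2 \<union> Y2) \<union> (X3 \<union> Y3)"
    by (auto simp: X_def Y_def)
  have prof: "profile X = (x1, x2, x3)" "profile Y = (y1, y2, y3)" "profile Z = (z1, z2, z3)"
    "profile (X \<union> Y) = (t1, t2, t3)"
    unfolding XY unfolding X_def Y_def Z_def using 1 2 3 by (subst profile_Un_blocks; simp)+
  have V: "X \<subseteq> V" "Y \<subseteq> V" "Z \<subseteq> V" and Z: "X \<union> Z = Z" "Y \<union> Z = Z"
    using 1 2 3 by (auto simp: X_def Y_def Z_def V_def)
  have abs: "p ` Z \<in> B" if "p \<in> block_perms" "p ` X \<in> B \<or> p ` Y \<in> B" for p
  proof -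
    have "p ` Z \<subseteq> V" "profile (p ` Z) = (z1, z2, z3)"
      using that(1) V(3) block_permsD(1)[OF that(1)] prof(3)
      by (auto simp: profile_image permutes_in_image)
    then show ?thesis using that(2) absorb Z by (metis image_Un)
  qed
  have "hits B X + hits B Y \<le> hits B (X \<union> Y) + hits B Z"
    unfolding hits_def sum.distrib[symmetric]
  proof (rule sum_mono)
    fix p assume "p \<in> block_perms"
    then show "of_bool (p ` X \<in> B) + of_bool (p ` Y \<in> B)
        \<le> of_bool (p ` (X \<union> Y) \<in> B) + (of_bool (p ` Z \<in> B) :: real)"
      using abs[of p] cl[of "p ` X" "p ` Y"] by (auto simp: image_Un)
  qed
  then show ?thesis
    using V by (simp add: hits_eq_profile_hits prof)
qed

lemma card_profile:
  "card {S. S \<subseteq> V \<and> profile S = (i, j, k)} = (card P choose i) * (card Q choose j) * (card R choose k)"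
proof -
  let ?D = "{S. S \<subseteq> P \<and> card S = i} \<times> {S. S \<subseteq> Q \<and> card S = j} \<times> {S. S \<subseteq> R \<and> card S = k}"
  have "bij_betw (\<lambda>(X, Y, Z). X \<union> Y \<union> Z) ?D {S. S \<subseteq> V \<and> profile S = (i, j, k)}"
  proof (rule bij_betw_byWitness[where f' = "\<lambda>S. (S \<inter> P, S \<inter> Q, S \<inter> R)"])
    show "\<forall>a\<in>?D. (\<lambda>S. (S \<inter> P, S \<inter> Q, S \<inter> R)) (case a of (X, Y, Z) \<Rightarrow> X \<union> Y \<union> Z) = a"
      using disj by auto
    show "\<forall>S\<in>{S. S \<subseteq> V \<and> profile S = (i, j, k)}.
        (case (S \<inter> P, S \<inter> Q, S \<inter> R) of (X, Y, Z) \<Rightarrow> X \<union> Y \<union> Z) = S"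
      by (auto simp: V_def)
    show "(\<lambda>(X, Y, Z). X \<union> Y \<union> Z) ` ?D \<subseteq> {S. S \<subseteq> V \<and> profile S = (i, j, k)}"
      by (auto simp: profile_Un_blocks V_def)
    show "(\<lambda>S. (S \<inter> P, S \<inter> Q, S \<inter> R)) ` {S. S \<subseteq> V \<and> profile S = (i, j, k)} \<subseteq> ?D"
      by (auto simp: profile_def)
  qed
  then show ?thesis
    using fin by (simp add: bij_betw_same_card[symmetric] card_cartesian_product n_subsets)
qed

lemma sum_family_eq:
  fixes g :: "nat \<times> nat \<times> nat \<Rightarrow> real"
  assumes B: "B \<subseteq> Pow V"
  shows "card block_perms * (\<Sum>S\<in>B. g (profile S)) =
    (\<Sum>i\<le>card P. \<Sum>j\<le>card Q. \<Sum>k\<le>card R.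
      ((card P choose i) * (card Q choose j) * (card R choose k)) * g (i, j, k) * profile_hits B (i, j, k))"
proof -
  have "card block_perms * (\<Sum>S\<in>B. g (profile S)) =
    (\<Sum>p\<in>block_perms. \<Sum>S\<in>Pow V. g (profile S) * of_bool (p ` S \<in> B))"
  proof -
    have "(\<Sum>S\<in>Pow V. g (profile S) * of_bool (p ` S \<in> B)) = (\<Sum>S\<in>B. g (profile S))"
      if p: "p \<in> block_perms" for p
    proof -
      note p' = block_permsD[OF p]
      have "(\<Sum>S\<in>Pow V. g (profile S) * of_bool (p ` S \<in> B)) =
        (\<Sum>S\<in>Pow V. g (profile (p ` S)) * of_bool (p ` S \<in> B))"
        by (simp add: profile_image[OF p])
      also have "\<dots> = (\<Sum>S\<in>Pow V. g (profile S) * of_bool (S \<in> B))"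
      proof (rule sum.reindex_bij_betw)
        show "bij_betw ((`) p) (Pow V) (Pow V)"
          using p'(1) by (intro bij_betw_Pow permutes_imp_bij)
      qed
      also have "\<dots> = (\<Sum>S\<in>B. g (profile S))"
        using B finite_V by (simp add: sum.If_cases of_bool_def if_distrib Int_absorb1 cong: if_cong)
      finally show ?thesis .
    qed
    then show ?thesis by simp
  qed
  also have "\<dots> = (\<Sum>S\<in>Pow V. g (profile S) * profile_hits B (profile S))"
    by (subst sum.swap) (simp add: sum_distrib_left[symmetric] hits_def[symmetric] hits_eq_profile_hits)
  also have "\<dots> = (\<Sum>s\<in>{..card P} \<times> {..card Q} \<times> {..card R}.
      \<Sum>S\<in>{S. S \<in> Pow V \<and> profile S = s}. g (profile S) * profile_hits B (profile S))"
    using fin finite_V by (intro sum.group[symmetric])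
      (auto simp: profile_def intro!: card_mono)
  also have "\<dots> = (\<Sum>(i, j, k)\<in>{..card P} \<times> {..card Q} \<times> {..card R}.
      ((card P choose i) * (card Q choose j) * (card R choose k)) * g (i, j, k) * profile_hits B (i, j, k))"
    by (intro sum.cong) (auto simp: card_profile mult.assoc)
  finally show ?thesis
    by (simp add: sum.cartesian_product)
qed

lemma card_block_perms_pos: "card block_perms > 0"
  using finite_block_perms id_block_perms by (auto simp: card_gt_0_iff)

section \<open>Linear inequalities for two missing pairs that are disjoint or share a point\<close>

lemma atMost_eqs:
  "{..1::nat} = {0, 1}" "{..2::nat} = {0, 1, 2}" "{..4::nat} = {0, 1, 2, 3, 4}"
  "{..5::nat} = {0, 1, 2, 3, 4, 5}"
  by auto

lemma choose_eqs:
  "(2::nat) choose 1 = 2" "(4::nat) choose 1 = 4" "(4::nat) choose 2 = 6" "(4::nat) choose 3 = 4"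
  "(5::nat) choose 1 = 5" "(5::nat) choose 2 = 10" "(5::nat) choose 3 = 10" "(5::nat) choose 4 = 5"
  by (simp_all add: eval_nat_numeral)

text \<open>
  The weights and the inequalities listed in the proofs were found by linear programming; the
  multipliers are recovered by linear arithmetic.
\<close>

lemma weighted_sum_disjoint:
  assumes cards: "card P = 2" "card Q = 2" "card R = 4"
    and B: "B \<subseteq> Pow V"
    and cl: "\<And>X Y. X \<in> B \<Longrightarrow> Y \<in> B \<Longrightarrow> X \<union> Y \<in> B"
    and absorb: "\<And>X Z i j k. X \<in> B \<Longrightarrow> Z \<subseteq> V \<Longrightarrow> profile Z = (i, j, k) \<Longrightarrow>
      6 \<le> i + j + k \<Longrightarrow> (i, j, k) \<noteq> (0, 2, 4) \<Longrightarrow> (i, j, k) \<noteq> (2, 0, 4) \<Longrightarrow> X \<union> Z \<in> B"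
  shows "110 * real (card B) \<le> (\<Sum>S\<in>B. 28 * card (S \<inter> P) + 28 * card (S \<inter> Q) + 27 * card (S \<inter> R))"
proof -
  define \<phi> where "\<phi> = profile_hits B"
  have union: "\<phi> (x1, x2, x3) + \<phi> (y1, y2, y3) \<le> \<phi> (t1, t2, t3) + \<phi> (z1, z2, z3)"
    if "x1 \<le> t1" "y1 \<le> t1" "t1 \<le> x1 + y1" "t1 \<le> z1" "z1 \<le> 2"
      "x2 \<le> t2" "y2 \<le> t2" "t2 \<le> x2 + y2" "t2 \<le> z2" "z2 \<le> 2"
      "x3 \<le> t3" "y3 \<le> t3" "t3 \<le> x3 + y3" "t3 \<le> z3" "z3 \<le> 4"
      "6 \<le> z1 + z2 + z3" "(z1, z2, z3) \<noteq> (0, 2, 4)" "(z1, z2, z3) \<noteq> (2, 0, 4)"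
    for x1 x2 x3 y1 y2 y3 t1 t2 t3 z1 z2 z3
    unfolding \<phi>_def
  proof (rule profile_hits_ineq[OF cl])
    fix X Z assume "X \<in> B" "Z \<subseteq> V" "profile Z = (z1, z2, z3)"
    then show "X \<union> Z \<in> B" using that(16-) by (rule absorb)
  qed (use that cards in simp_all)
  \<comment> \<open>The case \<open>X = Y\<close>, where one copy of
    \<open>\<phi> (x1, x2, x3)\<close> cancels.\<close>
  have up: "\<phi> (x1, x2, x3) \<le> \<phi> (z1, z2, z3)"
    if "x1 \<le> z1" "z1 \<le> 2" "x2 \<le> z2" "z2 \<le> 2" "x3 \<le> z3" "z3 \<le> 4"
      "6 \<le> z1 + z2 + z3" "(z1, z2, z3) \<noteq> (0, 2, 4)" "(z1, z2, z3) \<noteq> (2, 0, 4)"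
    for x1 x2 x3 z1 z2 z3
    using union[of x1 x1 x1 z1 x2 x2 x2 z2 x3 x3 x3 z3] that by simp
  have pos: "0 \<le> \<phi> s" for s
    by (simp add: \<phi>_def profile_hits_nonneg)
  have ups:
    "\<phi> (0, 0, 0) \<le> \<phi> (2, 1, 3)"
    "\<phi> (1, 1, 4) \<le> \<phi> (1, 2, 4)"
    "\<phi> (1, 2, 3) \<le> \<phi> (2, 2, 4)"
    "\<phi> (2, 1, 3) \<le> \<phi> (2, 1, 4)"
    "\<phi> (2, 1, 4) \<le> \<phi> (2, 2, 4)"
    "\<phi> (2, 2, 2) \<le> \<phi> (2, 2, 3)"
    by (rule up; simp)+
  have unions:
    "\<phi> (0, 0, 1) + \<phi> (0, 0, 1) \<le> \<phi> (0, 0, 2) + \<phi> (1, 1, 4)"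
    "\<phi> (0, 1, 0) + \<phi> (0, 0, 3) \<le> \<phi> (0, 1, 3) + \<phi> (1, 1, 4)"
    "\<phi> (0, 1, 2) + \<phi> (0, 0, 1) \<le> \<phi> (0, 1, 3) + \<phi> (1, 1, 4)"
    "\<phi> (0, 1, 2) + \<phi> (0, 1, 2) \<le> \<phi> (0, 2, 4) + \<phi> (1, 2, 4)"
    "\<phi> (0, 1, 3) + \<phi> (0, 0, 1) \<le> \<phi> (0, 1, 4) + \<phi> (1, 1, 4)"
    "\<phi> (0, 2, 1) + \<phi> (0, 0, 2) \<le> \<phi> (0, 2, 3) + \<phi> (1, 2, 3)"
    "\<phi> (1, 0, 0) + \<phi> (0, 2, 0) \<le> \<phi> (1, 2, 0) + \<phi> (1, 2, 3)"
    "\<phi> (1, 0, 1) + \<phi> (0, 0, 3) \<le> \<phi> (1, 0, 4) + \<phi> (1, 1, 4)"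
    "\<phi> (1, 0, 1) + \<phi> (0, 1, 2) \<le> \<phi> (1, 1, 3) + \<phi> (1, 1, 4)"
    "\<phi> (1, 0, 1) + \<phi> (0, 1, 2) \<le> \<phi> (1, 1, 3) + \<phi> (1, 2, 3)"
    "\<phi> (1, 0, 2) + \<phi> (0, 0, 4) \<le> \<phi> (1, 0, 4) + \<phi> (1, 1, 4)"
    "\<phi> (1, 0, 2) + \<phi> (0, 1, 1) \<le> \<phi> (1, 1, 3) + \<phi> (1, 2, 3)"
    "\<phi> (1, 0, 2) + \<phi> (1, 0, 2) \<le> \<phi> (2, 0, 4) + \<phi> (2, 1, 4)"
    "\<phi> (1, 0, 3) + \<phi> (1, 0, 1) \<le> \<phi> (2, 0, 3) + \<phi> (2, 1, 3)"
    "\<phi> (1, 1, 0) + \<phi> (0, 0, 3) \<le> \<phi> (1, 1, 3) + \<phi> (1, 1, 4)"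
    "\<phi> (1, 1, 0) + \<phi> (1, 0, 0) \<le> \<phi> (2, 1, 0) + \<phi> (2, 1, 3)"
    "\<phi> (1, 1, 1) + \<phi> (0, 1, 0) \<le> \<phi> (1, 2, 1) + \<phi> (1, 2, 3)"
    "\<phi> (1, 1, 1) + \<phi> (0, 1, 1) \<le> \<phi> (1, 2, 2) + \<phi> (2, 2, 2)"
    "\<phi> (1, 1, 1) + \<phi> (1, 0, 1) \<le> \<phi> (2, 1, 2) + \<phi> (2, 1, 3)"
    "\<phi> (1, 2, 0) + \<phi> (1, 0, 1) \<le> \<phi> (2, 2, 1) + \<phi> (2, 2, 2)"
    "\<phi> (1, 2, 1) + \<phi> (0, 0, 1) \<le> \<phi> (1, 2, 2) + \<phi> (2, 2, 2)"
    "\<phi> (2, 0, 0) + \<phi> (0, 0, 1) \<le> \<phi> (2, 0, 1) + \<phi> (2, 2, 2)"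
    "\<phi> (2, 0, 1) + \<phi> (0, 0, 2) \<le> \<phi> (2, 0, 3) + \<phi> (2, 1, 3)"
    "\<phi> (2, 0, 1) + \<phi> (0, 1, 0) \<le> \<phi> (2, 1, 1) + \<phi> (2, 1, 3)"
    "\<phi> (2, 1, 0) + \<phi> (0, 0, 2) \<le> \<phi> (2, 1, 2) + \<phi> (2, 2, 2)"
    "\<phi> (2, 1, 1) + \<phi> (0, 1, 0) \<le> \<phi> (2, 2, 1) + \<phi> (2, 2, 2)"
    "\<phi> (2, 1, 0) + \<phi> (0, 1, 0) \<le> \<phi> (2, 2, 0) + \<phi> (2, 2, 2)"
    "\<phi> (1, 0, 2) + \<phi> (0, 2, 0) \<le> \<phi> (1, 2, 2) + \<phi> (1, 2, 3)"
    by (rule union; simp)+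
  \<comment> \<open>The constant 110 is half the total weight
    \<open>28 * 2 + 28 * 2 + 27 * 4\<close>, so the claim says that \<open>g\<close> has a
    nonnegative sum over \<open>B\<close>.\<close>
  define g where "g = (\<lambda>(i, j, k). 28 * real i + 28 * real j + 27 * real k - 110)"
  have "0 \<le> (\<Sum>i\<le>card P. \<Sum>j\<le>card Q. \<Sum>k\<le>card R.
      ((card P choose i) * (card Q choose j) * (card R choose k)) * g (i, j, k) * profile_hits B (i, j, k))"
    unfolding cards \<phi>_def[symmetric]
    using ups unions pos
    by (simp add: g_def atMost_eqs choose_eqs)
  also have "\<dots> = card block_perms * (\<Sum>S\<in>B. g (profile S))"
    by (rule sum_family_eq[OF B, symmetric])
  finally have "0 \<le> (\<Sum>S\<in>B. g (profile S))"
    using card_block_perms_pos by (simp add: zero_le_mult_iff)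
  then show ?thesis
    by (simp add: g_def profile_def sum_subtractf mult.commute)
qed

lemma weighted_sum_adjacent:
  assumes cards: "card P = 1" "card Q = 2" "card R = 5"
    and B: "B \<subseteq> Pow V"
    and cl: "\<And>X Y. X \<in> B \<Longrightarrow> Y \<in> B \<Longrightarrow> X \<union> Y \<in> B"
    and absorb: "\<And>X Z i j k. X \<in> B \<Longrightarrow> Z \<subseteq> V \<Longrightarrow> profile Z = (i, j, k) \<Longrightarrow>
      6 \<le> i + j + k \<Longrightarrow> (i, j, k) \<noteq> (0, 1, 5) \<Longrightarrow> X \<union> Z \<in> B"
  shows "114 * real (card B) \<le> (\<Sum>S\<in>B. 30 * card (S \<inter> P) + 29 * card (S \<inter> Q) + 28 * card (S \<inter> R))"
proof -
  define \<phi> where "\<phi> = profile_hits B"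
  have union: "\<phi> (x1, x2, x3) + \<phi> (y1, y2, y3) \<le> \<phi> (t1, t2, t3) + \<phi> (z1, z2, z3)"
    if "x1 \<le> t1" "y1 \<le> t1" "t1 \<le> x1 + y1" "t1 \<le> z1" "z1 \<le> 1"
      "x2 \<le> t2" "y2 \<le> t2" "t2 \<le> x2 + y2" "t2 \<le> z2" "z2 \<le> 2"
      "x3 \<le> t3" "y3 \<le> t3" "t3 \<le> x3 + y3" "t3 \<le> z3" "z3 \<le> 5"
      "6 \<le> z1 + z2 + z3" "(z1, z2, z3) \<noteq> (0, 1, 5)"
    for x1 x2 x3 y1 y2 y3 t1 t2 t3 z1 z2 z3
    unfolding \<phi>_def
  proof (rule profile_hits_ineq[OF cl])
    fix X Z assume "X \<in> B" "Z \<subseteq> V" "profile Z = (z1, z2, z3)"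
    then show "X \<union> Z \<in> B" using that(16-) by (rule absorb)
  qed (use that cards in simp_all)
  have up: "\<phi> (x1, x2, x3) \<le> \<phi> (z1, z2, z3)"
    if "x1 \<le> z1" "z1 \<le> 1" "x2 \<le> z2" "z2 \<le> 2" "x3 \<le> z3" "z3 \<le> 5"
      "6 \<le> z1 + z2 + z3" "(z1, z2, z3) \<noteq> (0, 1, 5)"
    for x1 x2 x3 z1 z2 z3
    using union[of x1 x1 x1 z1 x2 x2 x2 z2 x3 x3 x3 z3] that by simp
  have pos: "0 \<le> \<phi> s" for s
    by (simp add: \<phi>_def profile_hits_nonneg)
  have ups:
    "\<phi> (0, 0, 0) \<le> \<phi> (1, 1, 4)"
    "\<phi> (1, 0, 5) \<le> \<phi> (1, 1, 5)"
    "\<phi> (1, 2, 3) \<le> \<phi> (1, 2, 4)"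
    "\<phi> (1, 1, 4) \<le> \<phi> (1, 2, 5)"
    by (rule up; simp)+
  have unions:
    "\<phi> (0, 0, 1) + \<phi> (0, 0, 1) \<le> \<phi> (0, 0, 2) + \<phi> (1, 0, 5)"
    "\<phi> (0, 0, 3) + \<phi> (0, 0, 2) \<le> \<phi> (0, 0, 5) + \<phi> (1, 0, 5)"
    "\<phi> (0, 1, 1) + \<phi> (0, 0, 3) \<le> \<phi> (0, 1, 4) + \<phi> (1, 1, 4)"
    "\<phi> (0, 1, 1) + \<phi> (0, 0, 4) \<le> \<phi> (0, 1, 5) + \<phi> (0, 2, 5)"
    "\<phi> (0, 1, 1) + \<phi> (0, 0, 4) \<le> \<phi> (0, 1, 5) + \<phi> (1, 1, 5)"
    "\<phi> (0, 1, 2) + \<phi> (0, 0, 2) \<le> \<phi> (0, 1, 4) + \<phi> (1, 1, 4)"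
    "\<phi> (0, 1, 2) + \<phi> (0, 1, 1) \<le> \<phi> (0, 2, 3) + \<phi> (0, 2, 4)"
    "\<phi> (0, 2, 0) + \<phi> (0, 0, 1) \<le> \<phi> (0, 2, 1) + \<phi> (1, 2, 3)"
    "\<phi> (0, 2, 1) + \<phi> (0, 0, 2) \<le> \<phi> (0, 2, 3) + \<phi> (0, 2, 4)"
    "\<phi> (1, 0, 0) + \<phi> (0, 0, 2) \<le> \<phi> (1, 0, 2) + \<phi> (1, 2, 3)"
    "\<phi> (1, 0, 0) + \<phi> (0, 1, 1) \<le> \<phi> (1, 1, 1) + \<phi> (1, 2, 3)"
    "\<phi> (1, 0, 0) + \<phi> (0, 1, 3) \<le> \<phi> (1, 1, 3) + \<phi> (1, 2, 3)"
    "\<phi> (1, 0, 1) + \<phi> (0, 1, 2) \<le> \<phi> (1, 1, 3) + \<phi> (1, 2, 3)"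
    "\<phi> (1, 0, 2) + \<phi> (0, 0, 2) \<le> \<phi> (1, 0, 4) + \<phi> (1, 0, 5)"
    "\<phi> (1, 0, 2) + \<phi> (0, 1, 0) \<le> \<phi> (1, 1, 2) + \<phi> (1, 2, 3)"
    "\<phi> (1, 1, 0) + \<phi> (0, 0, 2) \<le> \<phi> (1, 1, 2) + \<phi> (1, 1, 4)"
    "\<phi> (1, 1, 0) + \<phi> (0, 0, 3) \<le> \<phi> (1, 1, 3) + \<phi> (1, 1, 4)"
    "\<phi> (1, 1, 1) + \<phi> (0, 1, 1) \<le> \<phi> (1, 2, 2) + \<phi> (1, 2, 3)"
    "\<phi> (1, 1, 2) + \<phi> (0, 0, 1) \<le> \<phi> (1, 1, 3) + \<phi> (1, 1, 4)"
    "\<phi> (1, 1, 2) + \<phi> (0, 0, 1) \<le> \<phi> (1, 1, 3) + \<phi> (1, 2, 3)"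
    "\<phi> (1, 2, 0) + \<phi> (0, 0, 1) \<le> \<phi> (1, 2, 1) + \<phi> (1, 2, 3)"
    "\<phi> (1, 2, 1) + \<phi> (0, 0, 1) \<le> \<phi> (1, 2, 2) + \<phi> (1, 2, 3)"
    "\<phi> (0, 2, 1) + \<phi> (0, 1, 2) \<le> \<phi> (0, 2, 3) + \<phi> (0, 2, 4)"
    "\<phi> (0, 0, 3) + \<phi> (0, 0, 1) \<le> \<phi> (0, 0, 4) + \<phi> (1, 1, 4)"
    "\<phi> (1, 1, 1) + \<phi> (0, 0, 3) \<le> \<phi> (1, 1, 3) + \<phi> (1, 1, 4)"
    by (rule union; simp)+
  \<comment> \<open>Here half the total weight is
    \<open>(30 * 1 + 29 * 2 + 28 * 5) / 2 = 114\<close>.\<close>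
  define g where "g = (\<lambda>(i, j, k). 30 * real i + 29 * real j + 28 * real k - 114)"
  have "0 \<le> (\<Sum>i\<le>card P. \<Sum>j\<le>card Q. \<Sum>k\<le>card R.
      ((card P choose i) * (card Q choose j) * (card R choose k)) * g (i, j, k) * profile_hits B (i, j, k))"
    unfolding cards \<phi>_def[symmetric]
    using ups unions pos
    by (simp add: g_def atMost_eqs choose_eqs)
  also have "\<dots> = card block_perms * (\<Sum>S\<in>B. g (profile S))"
    by (rule sum_family_eq[OF B, symmetric])
  finally have "0 \<le> (\<Sum>S\<in>B. g (profile S))"
    using card_block_perms_pos by (simp add: zero_le_mult_iff)
  then show ?thesis
    by (simp add: g_def profile_def sum_subtractf mult.commute)
qed

end

section \<open>Weights and Frankl-completeness\<close>

text \<open>If every element of \<open>\<Union>A\<close> were rare in \<open>F\<close>, the weighted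
  count of memberships would be strictly below half the total weight times \<open>card F\<close>.
  Applying \<open>weighted\<close> to each layer of \<open>F\<close> with a fixed trace outside
  \<open>\<Union>A\<close> and summing gives the reverse inequality.\<close>

lemma frankl_complete_weightedI:
  fixes c :: "nat \<Rightarrow> real"
  assumes fin: "finite (\<Union>A)"
    and c: "\<And>i. i \<in> \<Union>A \<Longrightarrow> c i > 0" and ne: "\<Union>A \<noteq> {}"
    and weighted: "\<And>B. B \<subseteq> Pow (\<Union>A) \<Longrightarrow> union_closed B \<Longrightarrow> (\<And>S a. S \<in> B \<Longrightarrow> a \<in> A \<Longrightarrow> S \<union> a \<in> B) \<Longrightarrow>
      sum c (\<Union>A) / 2 * card B \<le> (\<Sum>S\<in>B. sum c S)"
  shows "frankl_complete A"
  unfolding frankl_complete_def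
proof (intro allI impI, elim conjE, rule ccontr)
  fix F assume F: "finite_family F" "union_closed F" "A \<subseteq> F"
    and neg: "\<not> (\<exists>i\<in>\<Union>A. real (card (members_with F i)) \<ge> real (card F) / 2)"
  define V where "V = \<Union>A"
  have finF: "finite F" using F(1) by (simp add: finite_family_def)
  define W where "W = sum c V"
  define h where "h S = sum c S - W / 2" for S
  have layer: "0 \<le> (\<Sum>S\<in>{S \<in> F. S - V = T}. h (S \<inter> V))" if "T \<in> (\<lambda>S. S - V) ` F" for T
  proof -
    from that have T: "T \<inter> V = {}" by auto
    \<comment> \<open>The layer over the outside trace \<open>T\<close>. Adding a member of
      \<open>A\<close> changes only the part inside \<open>V\<close>, so the layer absorbs
      \<open>A\<close>, although \<open>A\<close> itself may not be contained in it.\<close>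
    define B where "B = {S. S \<subseteq> V \<and> S \<union> T \<in> F}"
    have "W / 2 * card B \<le> (\<Sum>S\<in>B. sum c S)"
      unfolding W_def V_def
    proof (rule weighted)
      show "B \<subseteq> Pow (\<Union>A)" by (auto simp: B_def V_def)
      have "(S \<union> S') \<union> T \<in> F" if "S \<union> T \<in> F" "S' \<union> T \<in> F" for S S'
      proof -
        have "(S \<union> S') \<union> T = (S \<union> T) \<union> (S' \<union> T)" by auto
        with that F(2) show ?thesis by (simp add: union_closed_def)
      qed
      then show "union_closed B" by (auto simp: union_closed_def B_def)
      show "S \<union> a \<in> B" if "S \<in> B" "a \<in> A" for S a
      proof -
        have "(S \<union> a) \<union> T = (S \<union> T) \<union> a" by auto
        moreover have "(S \<union> T) \<union> a \<in> F"
          using that F(2,3) by (auto simp: union_closed_def B_def)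
        ultimately show ?thesis using that by (auto simp: B_def V_def)
      qed
    qed
    then have "0 \<le> (\<Sum>S\<in>B. h S)" by (simp add: h_def sum_subtractf mult.commute)
    also have "\<dots> = (\<Sum>S\<in>{S \<in> F. S - V = T}. h (S \<inter> V))"
      using T by (intro sum.reindex_bij_witness[where i = "\<lambda>S. S \<inter> V" and j = "\<lambda>S. S \<union> T"])
        (auto simp: B_def Int_Un_distrib2 Un_Diff Int_absorb2 Int_Diff_Un)
    finally show ?thesis .
  qed
  have "0 \<le> (\<Sum>T\<in>(\<lambda>S. S - V) ` F. \<Sum>S\<in>{S \<in> F. S - V = T}. h (S \<inter> V))"
    by (intro sum_nonneg layer)
  also have "\<dots> = (\<Sum>S\<in>F. h (S \<inter> V))"
    using finF by (intro sum.group) auto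
  finally have 1: "W / 2 * card F \<le> (\<Sum>S\<in>F. sum c (S \<inter> V))"
    by (simp add: h_def sum_subtractf mult.commute)
  also have "\<dots> = (\<Sum>S\<in>F. \<Sum>i\<in>V. if i \<in> S then c i else 0)"
    using fin by (simp add: V_def sum.inter_restrict Int_commute[of _ "\<Union>A"])
  also have "\<dots> = (\<Sum>i\<in>V. \<Sum>S\<in>F. if i \<in> S then c i else 0)"
    by (rule sum.swap)
  also have "\<dots> = (\<Sum>i\<in>V. c i * card (members_with F i))"
    using finF by (simp add: members_with_def mult.commute flip: sum.inter_filter)
  also have "\<dots> < (\<Sum>i\<in>V. c i * (card F / 2))"
  proof (intro sum_strict_mono mult_strict_left_mono)
    show "real (card (members_with F i)) < card F / 2" if "i \<in> V" for i
      using neg that unfolding V_def by (meson not_le)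
  qed (use fin ne c in \<open>simp_all add: V_def\<close>)
  also have "\<dots> = W / 2 * card F"
    by (simp add: W_def sum_distrib_right sum_divide_distrib)
  finally show False by simp
qed

section \<open>Reduction of 26 six-sets to two missing pairs\<close>

lemma ex_two_missing_pairs:
  assumes A: "A \<subseteq> Pow {1..8::nat}" and card_A: "26 \<le> card {S \<in> A. card S = 6}"
  obtains e f where "e \<subseteq> {1..8}" "f \<subseteq> {1..8}" "card e = 2" "card f = 2" "e \<noteq> f"
    "\<And>Z. Z \<subseteq> {1..8} \<Longrightarrow> card Z = 6 \<Longrightarrow> Z \<noteq> {1..8} - e \<Longrightarrow> Z \<noteq> {1..8} - f \<Longrightarrow> Z \<in> A"
proof -
  let ?V = "{1..8::nat}"
  define K where "K = {e. e \<subseteq> ?V \<and> card e = 2}"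
  define E where "E = {e \<in> K. ?V - e \<notin> A}"
  have card_K: "card K = 28" and finK: "finite K"
    unfolding K_def by (simp_all add: n_subsets choose_two)
  have card_co: "card (?V - S) = 8 - card S" if "S \<subseteq> ?V" for S
    using that by (simp add: card_Diff_subset finite_subset[OF that])
  have "(\<lambda>S. ?V - S) ` {S \<in> A. card S = 6} \<subseteq> K - E"
  proof
    fix e assume "e \<in> (\<lambda>S. ?V - S) ` {S \<in> A. card S = 6}"
    then obtain S where S: "S \<in> A" "card S = 6" "e = ?V - S" by auto
    moreover have "S \<subseteq> ?V" using S(1) A by auto
    moreover have "card e = 2" using card_co[OF calculation(4)] S by simp
    ultimately show "e \<in> K - E" by (simp add: K_def E_def double_diff)
  qed
  moreover have "inj_on (\<lambda>S. ?V - S) {S \<in> A. card S = 6}"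
    using A by (intro inj_on_inverseI[where g = "\<lambda>S. ?V - S"]) (auto simp: double_diff)
  ultimately have "card {S \<in> A. card S = 6} \<le> card (K - E)"
    using finK by (metis card_inj_on_le finite_Diff)
  also have "\<dots> = 28 - card E"
    using finK card_K by (subst card_Diff_subset) (auto simp: E_def)
  finally have "card E \<le> 2" using card_A by simp
  moreover have "E \<subseteq> K" by (auto simp: E_def)
  \<comment> \<open>If fewer than two six-sets are missing, further pairs are declared missing. This
    only gives up information and leaves exactly two pairs to treat.\<close>
  ultimately obtain E' where E': "E \<subseteq> E'" "E' \<subseteq> K" "card E' = 2"
    using exists_subset_between[of E 2 K] finK card_K by auto
  then obtain e f where ef: "E' = {e, f}" "e \<noteq> f" by (auto simp: card_2_iff)
  show thesis
  proof (rule that)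
    show "e \<subseteq> ?V" "f \<subseteq> ?V" "card e = 2" "card f = 2" "e \<noteq> f"
      using ef E' by (auto simp: K_def)
    fix Z assume Z: "Z \<subseteq> ?V" "card Z = 6" "Z \<noteq> ?V - e" "Z \<noteq> ?V - f"
    then have "?V - Z \<in> K" "?V - (?V - Z) = Z"
      using card_co[OF Z(1)] by (simp_all add: K_def double_diff)
    moreover have "?V - Z \<notin> E"
      using Z E'(1) ef by (metis calculation(2) insertE singletonD subsetD)
    ultimately show "Z \<in> A" by (auto simp: E_def)
  qed
qed

lemma ex_two_outside:
  assumes "finite V" "finite D" "card D + 2 \<le> card V"
  obtains u v where "u \<in> V" "v \<in> V" "u \<noteq> v" "u \<notin> D" "v \<notin> D"
proof -
  have "card V - card D \<le> card (V - D)" by (rule diff_card_le_card_Diff[OF assms(2)])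
  with assms(3) have "2 \<le> card (V - D)" by linarith
  then obtain T where "T \<subseteq> V - D" "card T = 2" by (meson obtain_subset_with_card_n)
  with that show thesis by (auto simp: card_2_iff)
qed

text \<open>Sets of size 7 and 8 are unions of available six-sets, which are absorbed one after the
  other. A pair with a point outside \<open>e \<union> f\<close> is neither \<open>e\<close> nor
  \<open>f\<close>, so its complement is available.\<close>

lemma absorbs_large_sets:
  assumes V: "card V = 8" and e: "card e = 2" and f: "card f = 2"
    and cl: "\<And>X Z. X \<in> B \<Longrightarrow> Z \<subseteq> V \<Longrightarrow> card Z = 6 \<Longrightarrow> Z \<noteq> V - e \<Longrightarrow> Z \<noteq> V - f \<Longrightarrow> X \<union> Z \<in> B"
    and Z: "X \<in> B" "Z \<subseteq> V" "6 \<le> card Z" "Z \<noteq> V - e" "Z \<noteq> V - f"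
  shows "X \<union> Z \<in> B"
proof -
  have fin: "finite V" "finite e" "finite f"
    using V e f by (auto intro: card_ge_0_finite)
  have ef: "card (e \<union> f) \<le> 4" using card_Un_le[of e f] e f by simp
  have seven: "Y \<union> (V - {u}) \<in> B" if "Y \<in> B" "u \<in> V" for Y u
  proof -
    \<comment> \<open>At most five of the eight points are excluded, which leaves room for
      \<open>v\<close> and \<open>w\<close>.\<close>
    have "card (insert u (e \<union> f)) \<le> 5" using ef card_insert_le_m1[of 5 "e \<union> f" u] by simp
    with V obtain v w where vw: "v \<in> V" "w \<in> V" "v \<noteq> w" "v \<notin> insert u (e \<union> f)" "w \<notin> insert u (e \<union> f)"
      using ex_two_outside[of V "insert u (e \<union> f)"] fin by auto
    have pair: "Y' \<union> (V - {u, x}) \<in> B" if "Y' \<in> B" "x \<in> V" "x \<notin> insert u (e \<union> f)" for Y' x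
    proof (rule cl[OF that(1)])
      show "card (V - {u, x}) = 6" using that \<open>u \<in> V\<close> V fin by (auto simp: card_Diff_subset card_insert_if)
      show "V - {u, x} \<noteq> V - e" "V - {u, x} \<noteq> V - f" using that by auto
    qed auto
    have "V - {u} = (V - {u, v}) \<union> (V - {u, w})" using vw by auto
    then show ?thesis
      using pair[OF pair[OF \<open>Y \<in> B\<close>, of v], of w] vw by (simp add: Un_assoc)
  qed
  have "card Z \<le> 8" using card_mono[OF fin(1) Z(2)] V by simp
  then consider "card Z = 6" | "card Z = 7" | "card Z = 8" using Z(3) by linarith
  then show ?thesis
  proof cases
    case 1 then show ?thesis using cl Z by blast
  next
    case 2
    then have "card (V - Z) = 1"
      using V Z(2) by (simp add: card_Diff_subset finite_subset[OF Z(2) fin(1)])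
    then obtain u where "V - Z = {u}" by (auto simp: card_1_singleton_iff)
    then have "Z = V - {u}" "u \<in> V" using Z(2) by auto
    then show ?thesis using seven Z(1) by simp
  next
    case 3
    then have "Z = V" using card_subset_eq[OF fin(1) Z(2)] V by simp
    obtain u v where uv: "u \<in> V" "v \<in> V" "u \<noteq> v"
      using ex_two_outside[of V "{}"] fin V by auto
    then have "V = (V - {u}) \<union> (V - {v})" by auto
    then show ?thesis using seven[OF seven[OF Z(1) uv(1)] uv(2)] \<open>Z = V\<close> by (simp add: Un_assoc)
  qed
qed

lemma (in three_blocks) card_profile_sum:
  assumes "Z \<subseteq> V" "profile Z = (i, j, k)"
  shows "card Z = i + j + k"
proof -
  have "Z = (Z \<inter> P) \<union> (Z \<inter> Q) \<union> (Z \<inter> R)" using assms(1) by (auto simp: V_def)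
  then have "card Z = card ((Z \<inter> P) \<union> (Z \<inter> Q) \<union> (Z \<inter> R))" by simp
  also have "\<dots> = card (Z \<inter> P) + card (Z \<inter> Q) + card (Z \<inter> R)"
    using fin disj by (subst card_Un_disjoint; (subst card_Un_disjoint)?; auto)
  finally show ?thesis using assms(2) by (simp add: profile_def)
qed

lemma (in three_blocks) sum_block_weights:
  fixes p q r :: real
  assumes "S \<subseteq> V"
  shows "(\<Sum>i\<in>S. if i \<in> P then p else if i \<in> Q then q else r) =
    p * card (S \<inter> P) + q * card (S \<inter> Q) + r * card (S \<inter> R)"
proof -
  let ?c = "\<lambda>i. if i \<in> P then p else if i \<in> Q then q else r"
  have "sum ?c S = sum ?c ((S \<inter> P) \<union> (S \<inter> Q) \<union> (S \<inter> R))"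
    using assms by (intro sum.cong) (auto simp: V_def)
  also have "\<dots> = sum ?c (S \<inter> P) + sum ?c (S \<inter> Q) + sum ?c (S \<inter> R)"
    using fin disj by (subst sum.union_disjoint; (subst sum.union_disjoint)?; auto)
  also have "sum ?c (S \<inter> P) = p * card (S \<inter> P)" by simp
  also have "sum ?c (S \<inter> Q) = (\<Sum>i\<in>S \<inter> Q. q)" using disj by (intro sum.cong) auto
  also have "sum ?c (S \<inter> R) = (\<Sum>i\<in>S \<inter> R. r)" using disj by (intro sum.cong) auto
  finally show ?thesis by simp
qed

text \<open>Weights constant on the blocks make the weight of a set a linear form in its profile,
  which is the quantity controlled by averaging.\<close>

lemma frankl_complete_block_weights:
  fixes P Q R :: "nat set" and p q r :: nat
  assumes blocks: "three_blocks P Q R" and pos: "p > 0" "q > 0" "r > 0"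
    and A: "\<Union>A = P \<union> Q \<union> R" and ne: "P \<union> Q \<union> R \<noteq> {}"
    and weighted: "\<And>B. B \<subseteq> Pow (P \<union> Q \<union> R) \<Longrightarrow> union_closed B \<Longrightarrow>
      (\<And>S a. S \<in> B \<Longrightarrow> a \<in> A \<Longrightarrow> S \<union> a \<in> B) \<Longrightarrow>
      real (p * card P + q * card Q + r * card R) / 2 * card B
        \<le> (\<Sum>S\<in>B. p * card (S \<inter> P) + q * card (S \<inter> Q) + r * card (S \<inter> R))"
  shows "frankl_complete A"
proof -
  interpret three_blocks P Q R by (rule blocks)
  let ?c = "\<lambda>i. if i \<in> P then real p else if i \<in> Q then real q else real r"
  have AV: "\<Union>A = V" using A by (simp add: V_def)
  show ?thesis
  proof (rule frankl_complete_weightedI[where c = ?c])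
    fix B assume B: "B \<subseteq> Pow (\<Union>A)" "union_closed B" "\<And>S a. S \<in> B \<Longrightarrow> a \<in> A \<Longrightarrow> S \<union> a \<in> B"
    have "V \<inter> P = P" "V \<inter> Q = Q" "V \<inter> R = R" by (auto simp: V_def)
    then have "sum ?c (\<Union>A) = p * card P + q * card Q + r * card R"
      by (simp add: AV sum_block_weights)
    moreover have "(\<Sum>S\<in>B. sum ?c S) = (\<Sum>S\<in>B. p * card (S \<inter> P) + q * card (S \<inter> Q) + r * card (S \<inter> R))"
      unfolding of_nat_sum using B(1) AV by (intro sum.cong) (auto simp: sum_block_weights)
    ultimately show "sum ?c (\<Union>A) / 2 * card B \<le> (\<Sum>S\<in>B. sum ?c S)"
      using weighted[OF B(1)[unfolded A] B(2,3)] by simp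
  qed (use pos finite_V ne A in \<open>auto simp: AV\<close>)
qed

lemma frankl_complete_26_six_sets:
  assumes A: "A \<subseteq> Pow {1..8::nat}" and card_A: "26 \<le> card {S \<in> A. card S = 6}"
  shows "frankl_complete A"
proof -
  let ?V = "{1..8::nat}"
  obtain e f where ef: "e \<subseteq> ?V" "f \<subseteq> ?V" "card e = 2" "card f = 2" "e \<noteq> f"
    and in_A: "\<And>Z. Z \<subseteq> ?V \<Longrightarrow> card Z = 6 \<Longrightarrow> Z \<noteq> ?V - e \<Longrightarrow> Z \<noteq> ?V - f \<Longrightarrow> Z \<in> A"
    using ex_two_missing_pairs[OF A card_A] by blast
  have fin: "finite e" "finite f" using ef(1,2) by (auto intro: finite_subset)
  \<comment> \<open>To cover \<open>x\<close>, leave out two points that differ from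
    \<open>x\<close> and lie in neither pair; the resulting six-set is not a missing one.\<close>
  have UA: "\<Union>A = ?V"
  proof
    show "?V \<subseteq> \<Union>A"
    proof
      fix x assume x: "x \<in> ?V"
      have "card (insert x (e \<union> f)) \<le> 5"
        using card_Un_le[of e f] ef(3,4) card_insert_le_m1[of 5 "e \<union> f" x] by simp
      then obtain u v where uv: "u \<in> ?V" "v \<in> ?V" "u \<noteq> v" "u \<notin> insert x (e \<union> f)" "v \<notin> insert x (e \<union> f)"
        using ex_two_outside[of ?V "insert x (e \<union> f)"] fin by auto
      have "?V - {u, v} \<in> A"
      proof (rule in_A)
        show "card (?V - {u, v}) = 6" using uv by (simp add: card_Diff_subset)
        show "?V - {u, v} \<noteq> ?V - e" "?V - {u, v} \<noteq> ?V - f" using uv by blast+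
      qed auto
      with x uv show "x \<in> \<Union>A" by blast
    qed
  qed (use A in auto)
  have absorb: "X \<union> Z \<in> B"
    if "\<And>S a. S \<in> B \<Longrightarrow> a \<in> A \<Longrightarrow> S \<union> a \<in> B"
      "X \<in> B" "Z \<subseteq> ?V" "6 \<le> card Z" "Z \<noteq> ?V - e" "Z \<noteq> ?V - f" for B X Z
    by (rule absorbs_large_sets[of ?V e f B]) (use that ef in_A in auto)
  show ?thesis
  proof (cases "e \<inter> f = {}")
    case True
    define R where "R = ?V - (e \<union> f)"
    have card_R: "card R = 4"
      using True ef fin by (simp add: R_def card_Diff_subset card_Un_disjoint)
    interpret three_blocks e f R
      by unfold_locales (use fin True in \<open>auto simp: R_def\<close>)
    have V: "V = ?V" using ef unfolding V_def by (auto simp: R_def)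
    \<comment> \<open>The two profiles exempted from absorption in
      \<open>weighted_sum_disjoint\<close> are those of the missing six-sets.\<close>
    have prof: "profile (?V - e) = (0, 2, 4)" "profile (?V - f) = (2, 0, 4)"
    proof -
      have "(?V - e) \<inter> e = {}" "(?V - e) \<inter> f = f" "(?V - e) \<inter> R = R"
        "(?V - f) \<inter> e = e" "(?V - f) \<inter> f = {}" "(?V - f) \<inter> R = R"
        using True ef(1,2) by (auto simp: R_def)
      then show "profile (?V - e) = (0, 2, 4)" "profile (?V - f) = (2, 0, 4)"
        using ef card_R by (simp_all add: profile_def)
    qed
    show ?thesis
    proof (rule frankl_complete_block_weights[of e f R 28 28 27])
      show "three_blocks e f R" by unfold_locales
      show "\<Union>A = e \<union> f \<union> R" "e \<union> f \<union> R \<noteq> {}" using UA V by (auto simp: V_def)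
      fix B assume B: "B \<subseteq> Pow (e \<union> f \<union> R)" "union_closed B"
        "\<And>S a. S \<in> B \<Longrightarrow> a \<in> A \<Longrightarrow> S \<union> a \<in> B"
      have "110 * real (card B)
          \<le> (\<Sum>S\<in>B. 28 * card (S \<inter> e) + 28 * card (S \<inter> f) + 27 * card (S \<inter> R))"
      proof (rule weighted_sum_disjoint)
        fix X Z i j k
        assume "X \<in> B" "Z \<subseteq> V" "profile Z = (i, j, k)" "6 \<le> i + j + k"
          "(i, j, k) \<noteq> (0, 2, 4)" "(i, j, k) \<noteq> (2, 0, 4)"
        then show "X \<union> Z \<in> B"
          using prof card_profile_sum V by (intro absorb[OF B(3)]) auto
      qed (use B ef card_R in \<open>auto simp: V_def union_closed_def\<close>)
      then show "real (28 * card e + 28 * card f + 27 * card R) / 2 * card B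
          \<le> (\<Sum>S\<in>B. 28 * card (S \<inter> e) + 28 * card (S \<inter> f) + 27 * card (S \<inter> R))"
        using ef card_R by simp
    qed simp_all
  next
    case False
    then obtain a b c where abc: "e = {a, b}" "f = {a, c}" "a \<noteq> b" "a \<noteq> c" "b \<noteq> c"
      using ef(3,4,5) by (auto simp: card_2_iff doubleton_eq_iff)
    have in_V: "a \<in> ?V" "b \<in> ?V" "c \<in> ?V" using ef(1,2) abc by auto
    define R where "R = ?V - {a, b, c}"
    have card_R: "card R = 5"
      using abc in_V by (simp add: R_def card_Diff_subset)
    interpret three_blocks "{a}" "{b, c}" R
      by unfold_locales (use abc in \<open>auto simp: R_def\<close>)
    have V: "V = ?V" using in_V unfolding V_def by (auto simp: R_def)
    \<comment> \<open>Exchanging \<open>b\<close> and \<open>c\<close> exchanges the two missing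
      six-sets, so a single exempted profile covers both.\<close>
    have prof: "profile (?V - e) = (0, 1, 5)" "profile (?V - f) = (0, 1, 5)"
    proof -
      have "(?V - e) \<inter> {a} = {}" "(?V - e) \<inter> {b, c} = {c}" "(?V - e) \<inter> R = R"
        "(?V - f) \<inter> {a} = {}" "(?V - f) \<inter> {b, c} = {b}" "(?V - f) \<inter> R = R"
        using abc in_V by (auto simp: R_def)
      then show "profile (?V - e) = (0, 1, 5)" "profile (?V - f) = (0, 1, 5)"
        using card_R by (simp_all add: profile_def)
    qed
    show ?thesis
    proof (rule frankl_complete_block_weights[of "{a}" "{b, c}" R 30 29 28])
      show "three_blocks {a} {b, c} R" by unfold_locales
      show "\<Union>A = {a} \<union> {b, c} \<union> R" "{a} \<union> {b, c} \<union> R \<noteq> {}" using UA V by (auto simp: V_def)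
      fix B assume B: "B \<subseteq> Pow ({a} \<union> {b, c} \<union> R)" "union_closed B"
        "\<And>S a. S \<in> B \<Longrightarrow> a \<in> A \<Longrightarrow> S \<union> a \<in> B"
      have "114 * real (card B)
          \<le> (\<Sum>S\<in>B. 30 * card (S \<inter> {a}) + 29 * card (S \<inter> {b, c}) + 28 * card (S \<inter> R))"
      proof (rule weighted_sum_adjacent)
        fix X Z i j k
        assume "X \<in> B" "Z \<subseteq> V" "profile Z = (i, j, k)" "6 \<le> i + j + k" "(i, j, k) \<noteq> (0, 1, 5)"
        then show "X \<union> Z \<in> B"
          using prof card_profile_sum V by (intro absorb[OF B(3)]) auto
      qed (use B abc card_R in \<open>auto simp: V_def union_closed_def\<close>)
      then show "real (30 * card {a} + 29 * card {b, c} + 28 * card R) / 2 * card B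
          \<le> (\<Sum>S\<in>B. 30 * card (S \<inter> {a}) + 29 * card (S \<inter> {b, c}) + 28 * card (S \<inter> R))"
        using abc card_R by simp
    qed simp_all
  qed
qed

section \<open>A family of 25 six-sets that is not Frankl-complete\<close>

text \<open>Summed over a finite family, it counts the members containing \<open>j\<close> minus
  those avoiding \<open>j\<close>; thus \<open>j\<close> is rare exactly when the sum is negative,
  and contributions of disjoint subfamilies add.\<close>

definition incidence_sign :: "nat \<Rightarrow> nat set \<Rightarrow> int" where
  "incidence_sign j S = (if j \<in> S then 1 else -1)"

lemma sum_incidence_sign:
  assumes "finite F"
  shows "(\<Sum>S\<in>F. incidence_sign j S) = 2 * int (card (members_with F j)) - int (card F)"
proof -
  have "(\<Sum>S\<in>F. incidence_sign j S) = (\<Sum>S\<in>F. 2 * of_bool (j \<in> S) - 1)"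
    by (intro sum.cong) (auto simp: incidence_sign_def)
  also have "\<dots> = 2 * int (card (members_with F j)) - int (card F)"
    using assms by (simp add: sum_subtractf sum_distrib_left[symmetric] members_with_def Int_def)
  finally show ?thesis .
qed

text \<open>Toggling \<open>j\<close> is an involution of the power set that reverses the
  sign.\<close>

lemma sum_incidence_sign_Pow:
  assumes "j \<in> V"
  shows "(\<Sum>S\<in>Pow V. incidence_sign j S) = 0"
proof -
  let ?t = "\<lambda>S. if j \<in> S then S - {j} else insert j S"
  have "(\<Sum>S\<in>Pow V. incidence_sign j S) = (\<Sum>S\<in>Pow V. - incidence_sign j S)"
    using assms by (intro sum.reindex_bij_witness[of _ ?t ?t]) (auto simp: incidence_sign_def)
  then show ?thesis by (simp add: sum_negf)
qed

text \<open>
  The union of two different sets \<open>X - {x}\<close> is \<open>X\<close>, where the full power set of \<open>V\<close> is placed at no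
  cost. So the families \<open>L x\<close> need not be compatible with each other.
\<close>

lemma not_frankl_complete_layersI:
  fixes V X :: "nat set" and L :: "nat \<Rightarrow> nat set set"
  assumes fin: "finite V" "finite X" and disj: "V \<inter> X = {}" and two: "\<And>x. X - {x} \<noteq> {}"
    and A: "A \<subseteq> U" and U: "U \<subseteq> Pow V" "union_closed U"
    and L: "\<And>x. x \<in> X \<Longrightarrow> L x \<subseteq> Pow V" "\<And>x. x \<in> X \<Longrightarrow> union_closed (L x)"
      "\<And>x S T. x \<in> X \<Longrightarrow> S \<in> U \<Longrightarrow> T \<in> L x \<Longrightarrow> S \<union> T \<in> L x"
    and neg: "\<And>j. j \<in> \<Union>A \<Longrightarrow>
      (\<Sum>S\<in>U. incidence_sign j S) + (\<Sum>x\<in>X. \<Sum>S\<in>L x. incidence_sign j S) < 0"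
  shows "\<not> frankl_complete A"
proof
  assume fc: "frankl_complete A"
  define layer where "layer x = (\<lambda>S. S \<union> (X - {x})) ` L x" for x
  define Top where "Top = (\<lambda>S. S \<union> X) ` Pow V"
  \<comment> \<open>The pieces are told apart by their traces on \<open>X\<close>: empty on
    \<open>U\<close>, \<open>X - {x}\<close> on \<open>layer x\<close>, and \<open>X\<close> on
    \<open>Top\<close>. By \<open>two\<close>, the first differs from all the others.\<close>
  define F where "F = U \<union> (\<Union>x\<in>X. layer x) \<union> Top"
  have tr_U: "S \<inter> X = {}" if "S \<in> U" for S using that U(1) disj by auto
  have tr_layer: "S \<inter> X = X - {x}" if "S \<in> layer x" "x \<in> X" for S x
    using that(1) L(1)[OF that(2)] disj by (auto simp: layer_def)
  have tr_Top: "S \<inter> X = X" if "S \<in> Top" for S using that by (auto simp: Top_def)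
  have finU: "finite U" using U(1) fin by (meson finite_Pow_iff finite_subset)
  have finL: "finite (L x)" if "x \<in> X" for x using L(1)[OF that] fin by (meson finite_Pow_iff finite_subset)
  have fin_parts: "finite (\<Union>x\<in>X. layer x)" "finite Top"
    using fin finL by (auto simp: layer_def Top_def)
  have mem_layer: "S \<union> (X - {x}) \<in> F" if "x \<in> X" "S \<in> L x" for S x
    using that by (auto simp: F_def layer_def)
  have mem_Top: "S \<in> F" if "X \<subseteq> S" "S \<subseteq> V \<union> X" for S
  proof -
    have "S = (S - X) \<union> X" "S - X \<in> Pow V" using that by auto
    then have "S \<in> Top" unfolding Top_def by (rule image_eqI)
    then show ?thesis by (simp add: F_def)
  qed
  have F_sub: "S \<subseteq> V \<union> X" if "S \<in> F" for S
  proof -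
    have "S \<subseteq> V \<union> X" if "x \<in> X" "S \<in> layer x" for x
      using that L(1)[OF that(1)] by (auto simp: layer_def)
    with that U(1) show ?thesis by (auto simp: F_def Top_def)
  qed
  have uc: "union_closed F"
    unfolding union_closed_def
  proof (intro ballI)
    fix S T assume ST: "S \<in> F" "T \<in> F"
    show "S \<union> T \<in> F"
    \<comment> \<open>A union containing all of \<open>X\<close> lands in \<open>Top\<close>, where
      every subset of \<open>V\<close> is present. Otherwise at most one layer is involved, since
      two distinct traces \<open>X - {x}\<close> and \<open>X - {y}\<close> cover
      \<open>X\<close>.\<close>
    proof (cases "X \<subseteq> S \<union> T")
      case True
      then show ?thesis using F_sub ST by (intro mem_Top) auto
    next
      case False
      then have "S \<notin> Top" "T \<notin> Top" by (auto simp: Top_def)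
      with ST consider "S \<in> U" "T \<in> U"
        | x where "x \<in> X" "S \<in> U" "T \<in> layer x"
        | x where "x \<in> X" "S \<in> layer x" "T \<in> U"
        | x y where "x \<in> X" "y \<in> X" "S \<in> layer x" "T \<in> layer y"
        by (auto simp: F_def)
      then show ?thesis
      proof cases
        case 1
        then show ?thesis using U(2) by (auto simp: F_def union_closed_def)
      next
        case 2
        then obtain T' where T': "T' \<in> L x" "T = T' \<union> (X - {x})" by (auto simp: layer_def)
        have "(S \<union> T') \<union> (X - {x}) \<in> F" using 2 T'(1) L(3) by (intro mem_layer) auto
        then show ?thesis by (simp add: T'(2) Un_assoc)
      next
        case 3
        then obtain S' where S': "S' \<in> L x" "S = S' \<union> (X - {x})" by (auto simp: layer_def)
        have "(T \<union> S') \<union> (X - {x}) \<in> F" using 3 S'(1) L(3) by (intro mem_layer) auto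
        then show ?thesis by (simp add: S'(2) Un_ac)
      next
        case 4
        then obtain S' T' where S': "S' \<in> L x" "S = S' \<union> (X - {x})"
          and T': "T' \<in> L y" "T = T' \<union> (X - {y})" by (auto simp: layer_def)
        with False have "x = y" by auto
        with S' T' 4 L(2) have "(S' \<union> T') \<union> (X - {x}) \<in> F"
          by (intro mem_layer) (auto simp: union_closed_def)
        moreover have "S \<union> T = (S' \<union> T') \<union> (X - {x})"
          using S'(2) T'(2) \<open>x = y\<close> by auto
        ultimately show ?thesis by simp
      qed
    qed
  qed
  have finF: "finite F" using finU fin_parts by (simp add: F_def)
  have "finite S" if "S \<in> F" for S
    using F_sub[OF that] fin by (meson finite_UnI finite_subset)
  with finF have "finite_family F" by (simp add: finite_family_def)
  moreover have "A \<subseteq> F" using A by (auto simp: F_def)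
  ultimately obtain j where j: "j \<in> \<Union>A" "real (card (members_with F j)) \<ge> real (card F) / 2"
    using fc uc unfolding frankl_complete_def by blast
  have jV: "j \<in> V" "j \<notin> X" using j(1) A U(1) disj by auto
  have sign: "incidence_sign j (S \<union> T) = incidence_sign j S" if "T \<subseteq> X" for S T
    using jV that by (auto simp: incidence_sign_def)
  have reindex: "(\<Sum>S\<in>(\<lambda>S. S \<union> T) ` M. incidence_sign j S) = (\<Sum>S\<in>M. incidence_sign j S)"
    if "T \<subseteq> X" "M \<subseteq> Pow V" for T M
  proof -
    have "inj_on (\<lambda>S. S \<union> T) M" using that disj by (intro inj_onI) blast
    then show ?thesis using sign[OF that(1)] by (simp add: sum.reindex)
  qed
  have "(\<Sum>S\<in>F. incidence_sign j S)
      = (\<Sum>S\<in>U. incidence_sign j S) + (\<Sum>S\<in>(\<Union>x\<in>X. layer x). incidence_sign j S)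
        + (\<Sum>S\<in>Top. incidence_sign j S)"
  proof -
    have UL: "S \<notin> layer x" if "x \<in> X" "S \<in> U" for S x
      using tr_U[OF that(2)] tr_layer[OF _ that(1), of S] two[of x] by auto
    have LT: "S \<notin> Top" if "x \<in> X" "S \<in> layer x" for S x
      using tr_Top[of S] tr_layer[OF that(2,1)] that(1) by auto
    have "S \<notin> Top" if "S \<in> U" for S
      using tr_U[OF that] tr_Top[of S] two by auto
    with UL LT have "U \<inter> (\<Union>x\<in>X. layer x) = {}" "(U \<union> (\<Union>x\<in>X. layer x)) \<inter> Top = {}"
      by blast+
    then show ?thesis
      unfolding F_def using finU fin_parts by (simp add: sum.union_disjoint)
  qed
  also have "(\<Sum>S\<in>(\<Union>x\<in>X. layer x). incidence_sign j S) = (\<Sum>x\<in>X. \<Sum>S\<in>layer x. incidence_sign j S)"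
  proof (rule sum.UNION_disjoint[OF fin(2)])
    show "\<forall>x\<in>X. finite (layer x)" using finL by (simp add: layer_def)
    show "\<forall>x\<in>X. \<forall>y\<in>X. x \<noteq> y \<longrightarrow> layer x \<inter> layer y = {}" using tr_layer by blast
  qed
  also have "\<dots> = (\<Sum>x\<in>X. \<Sum>S\<in>L x. incidence_sign j S)"
    unfolding layer_def
  proof (rule sum.cong[OF refl])
    fix x assume "x \<in> X"
    then show "(\<Sum>S\<in>(\<lambda>S. S \<union> (X - {x})) ` L x. incidence_sign j S) = (\<Sum>S\<in>L x. incidence_sign j S)"
      using L(1) by (intro reindex) auto
  qed
  also have "(\<Sum>S\<in>Top. incidence_sign j S) = 0"
    unfolding Top_def using reindex[of X "Pow V"] sum_incidence_sign_Pow[OF jV(1)] by simp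
  finally have "(\<Sum>S\<in>F. incidence_sign j S) < 0" using neg[OF j(1)] by simp
  then show False using j(2) sum_incidence_sign[OF finF, of j] by linarith
qed

section \<open>The matching, the multiplicities and the numerical check\<close>

definition matching :: "nat set set" where
  "matching = {{1, 2}, {3, 4}, {5, 6}}"

text \<open>These are the complements of the members of \<open>U\<close> in
  \<open>not_frankl_complete_25\<close>, so sums over large sets become sums over the empty set,
  singletons and pairs.\<close>

definition small_complements :: "nat set set" where
  "small_complements = {E. E \<subseteq> {1..8} \<and> card E \<le> 2 \<and> E \<notin> matching}"

text \<open>
  The element \<open>x\<close> of \<open>extras\<close> carries the layer with \<open>i = x div 10\<close>; leaving out 79 makes the
  multiplicity of 7 equal to that of 8.
\<close>

definition extras :: "nat set" where
  "extras = {10..88} - {79}"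

text \<open>For \<open>i\<close> from 1 to 8, the number of elements of \<open>extras\<close> whose
  layer belongs to \<open>i\<close>. A common multiplicity \<open>m\<close> would fail: for a
  matched \<open>j\<close>, the sum in \<open>weighted_signs_negative\<close>, with
  \<open>1 + 8 * m\<close> in place of 79, would be \<open>20 + 128 * m\<close> and exceed
  \<open>128 * m\<close>. The unmatched elements 7 and 8 have slack and get fewer copies.\<close>

definition multiplicity :: "nat \<Rightarrow> int" where
  "multiplicity i = (if i \<le> 6 then 10 else 9)"

lemma sum_extras:
  fixes g :: "nat \<Rightarrow> int"
  shows "(\<Sum>x\<in>extras. g (x div 10)) = (\<Sum>i\<in>{1..8}. multiplicity i * g i)"
proof -
  have eq: "{x \<in> extras. x div 10 = i} = (if i \<le> 6 then {10 * i..10 * i + 9} else {10 * i..10 * i + 8})"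
    if "i \<in> {1..8}" for i
    using that by (auto simp: extras_def) presburger+
  have "(\<Sum>x\<in>extras. g (x div 10)) = (\<Sum>i\<in>{1..8}. \<Sum>x\<in>{x \<in> extras. x div 10 = i}. g (x div 10))"
    by (intro sum.group[symmetric]) (auto simp: extras_def)
  also have "\<dots> = (\<Sum>i\<in>{1..8}. multiplicity i * g i)"
  proof (rule sum.cong[OF refl])
    fix i :: nat assume i: "i \<in> {1..8}"
    have "(\<Sum>x\<in>{x \<in> extras. x div 10 = i}. g (x div 10)) = card {x \<in> extras. x div 10 = i} * g i"
      by simp
    then show "(\<Sum>x\<in>{x \<in> extras. x div 10 = i}. g (x div 10)) = multiplicity i * g i"
      unfolding eq[OF i] by (simp add: multiplicity_def)
  qed
  finally show ?thesis .
qed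

text \<open>In this form the sum can be evaluated by simplification; each pair occurs once, listed
  under its larger element \<open>l\<close>.\<close>

lemma sum_small_complements:
  fixes g :: "nat set \<Rightarrow> int"
  shows "(\<Sum>E\<in>small_complements. g E) =
    g {} + (\<Sum>k\<in>{1..8}. g {k}) + (\<Sum>l\<in>{1..8}. \<Sum>k\<in>{1..<l}. g {k, l})
    - (g {1, 2} + g {3, 4} + g {5, 6})"
proof -
  define D where "D = (SIGMA l:{1..8::nat}. {1..<l})"
  define Sing where "Sing = (\<lambda>k. {k}) ` {1..8::nat}"
  define Pairs where "Pairs = (\<lambda>(l, k). {k, l}) ` D"
  have fin: "finite Sing" "finite Pairs" by (auto simp: Sing_def Pairs_def D_def)
  have inj: "inj_on (\<lambda>(l, k). {k, l}) D"
    by (auto simp: inj_on_def D_def doubleton_eq_iff)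
  have matching_sub: "matching \<subseteq> Pairs"
  proof -
    have "(2, 1) \<in> D" "(4, 3) \<in> D" "(6, 5) \<in> D" by (auto simp: D_def)
    then show ?thesis unfolding matching_def Pairs_def by (auto intro: rev_image_eqI)
  qed
  have card1: "card E = 1" if "E \<in> Sing" for E using that by (auto simp: Sing_def)
  have card2: "card E = 2" if "E \<in> Pairs" for E using that by (auto simp: Pairs_def D_def)
  have eq: "small_complements = ({{}} \<union> Sing \<union> Pairs) - matching"
  proof -
    have "E \<in> {{}} \<union> Sing \<union> Pairs" if "E \<subseteq> {1..8}" "card E \<le> 2" for E
    proof -
      from that(2) consider "card E = 0" | "card E = 1" | "card E = 2" by linarith
      then show ?thesis
      proof cases
        case 1 then show ?thesis using that(1) finite_subset by fastforce
      next
        case 2 then show ?thesis using that(1) by (auto simp: card_1_singleton_iff Sing_def)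
      next
        case 3
        then obtain k l where E: "E = {k, l}" "k < l"
          unfolding card_2_iff by (metis insert_commute nat_neq_iff)
        then have "(l, k) \<in> D" using that(1) by (auto simp: D_def)
        then show ?thesis using E(1) by (auto simp: Pairs_def intro: rev_image_eqI)
      qed
    qed
    moreover have "E \<subseteq> {1..8} \<and> card E \<le> 2" if "E \<in> {{}} \<union> Sing \<union> Pairs" for E
      using that card1 card2 by (fastforce simp: Sing_def Pairs_def D_def)
    ultimately show ?thesis unfolding small_complements_def by blast
  qed
  have "(\<Sum>E\<in>small_complements. g E) = (\<Sum>E\<in>{{}} \<union> Sing \<union> Pairs. g E) - (\<Sum>E\<in>matching. g E)"
    unfolding eq by (rule sum_diff) (use fin matching_sub in auto)
  also have "(\<Sum>E\<in>{{}} \<union> Sing \<union> Pairs. g E) = g {} + (\<Sum>E\<in>Sing. g E) + (\<Sum>E\<in>Pairs. g E)"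
  proof -
    have "({{}} \<union> Sing) \<inter> Pairs = {}" "{{}} \<inter> Sing = {}" using card1 card2 by fastforce+
    then show ?thesis using fin by (simp add: sum.union_disjoint del: Un_insert_left)
  qed
  also have "(\<Sum>E\<in>Sing. g E) = (\<Sum>k\<in>{1..8}. g {k})"
    unfolding Sing_def by (subst sum.reindex) auto
  also have "(\<Sum>E\<in>Pairs. g E) = (\<Sum>l\<in>{1..8}. \<Sum>k\<in>{1..<l}. g {k, l})"
    unfolding Pairs_def sum.reindex[OF inj] by (simp add: D_def sum.Sigma case_prod_unfold)
  also have "(\<Sum>E\<in>matching. g E) = g {1, 2} + g {3, 4} + g {5, 6}"
    by (simp add: matching_def doubleton_eq_iff)
  finally show ?thesis .
qed

text \<open>Apart from the power sets \<open>Pow ({1..8} - {i})\<close>, the set with complement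
  \<open>E\<close> occurs once in \<open>U\<close> and in \<open>multiplicity i\<close> layers for
  each of its elements \<open>i\<close>, in total \<open>1 + 78 - sum multiplicity E\<close> times.
  The right side counts the \<open>2 ^ 7\<close> sets avoiding \<open>j\<close> in each layer of
  \<open>j\<close>. The values are 1272 against 1280 for \<open>j \<le> 6\<close>, and 1140 against
  1152 for 7 and 8.\<close>

lemma weighted_signs_negative:
  assumes "j \<in> {1..8}"
  shows "(\<Sum>E\<in>small_complements. - incidence_sign j E * (79 - sum multiplicity E)) < 128 * multiplicity j"
proof -
  have iv: "{1..8::nat} = {1, 2, 3, 4, 5, 6, 7, 8}" by auto
  have lt: "{1..<1::nat} = {}" "{1..<2::nat} = {1}" "{1..<3::nat} = {1, 2}" "{1..<4::nat} = {1, 2, 3}"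
    "{1..<5::nat} = {1, 2, 3, 4}" "{1..<6::nat} = {1, 2, 3, 4, 5}" "{1..<7::nat} = {1, 2, 3, 4, 5, 6}"
    "{1..<8::nat} = {1, 2, 3, 4, 5, 6, 7}"
    by auto
  show ?thesis
    using assms unfolding sum_small_complements iv
    by (elim insertE emptyE; hypsubst) (simp_all add: lt incidence_sign_def multiplicity_def del: One_nat_def)
qed

lemma not_frankl_complete_25:
  "\<not> frankl_complete {S. S \<subseteq> {1..8} \<and> card S = 6 \<and> {1..8} - S \<notin> matching}"
    (is "\<not> frankl_complete ?A")
proof -
  let ?V = "{1..8::nat}"
  define U where "U = {S. S \<subseteq> ?V \<and> 6 \<le> card S \<and> ?V - S \<notin> matching}"
  define B where "B i = Pow (?V - {i}) \<union> U" for i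
  have co: "?V - (?V - S) = S" "card (?V - S) = 8 - card S" if "S \<subseteq> ?V" for S
    using that by (auto simp: double_diff card_Diff_subset finite_subset[OF that])
  have card_matching: "card E = 2" if "E \<in> matching" for E
    using that by (auto simp: matching_def)
  \<comment> \<open>A proper superset has at least seven elements, so its complement is too small to
    belong to the matching.\<close>
  have up: "T \<in> U" if "S \<in> U" "S \<subseteq> T" "T \<subseteq> ?V" for S T
  proof (cases "T = S")
    case False
    then have lt: "card S < card T"
      using that by (intro psubset_card_mono) (auto intro: finite_subset)
    moreover have "6 \<le> card S" using that(1) by (simp add: U_def)
    ultimately have "card (?V - T) \<noteq> 2" using co(2)[OF that(3)] by linarith
    with lt that card_matching show ?thesis unfolding U_def by fastforce
  qed (use that in simp)
  have U_sub: "U \<subseteq> Pow ?V" by (auto simp: U_def)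
  have U_union: "S \<union> T \<in> U" if "S \<in> U" "T \<subseteq> ?V" for S T
    using up[OF that(1), of "S \<union> T"] that U_sub by auto
  have sum_U: "(\<Sum>S\<in>U. g S) = (\<Sum>E\<in>small_complements. g (?V - E))" for g :: "nat set \<Rightarrow> int"
  proof (rule sum.reindex_bij_witness[where i = "\<lambda>E. ?V - E" and j = "\<lambda>S. ?V - S"])
    show "?V - (?V - S) = S" "?V - S \<in> small_complements" "g (?V - (?V - S)) = g S" if "S \<in> U" for S
      using that co[of S] by (auto simp: U_def small_complements_def)
    show "?V - (?V - E) = E" "?V - E \<in> U" if "E \<in> small_complements" for E
      using that co[of E] by (auto simp: U_def small_complements_def)
  qed
  have finU: "finite U" using U_sub by (rule finite_subset) simp
  have sum_B: "(\<Sum>S\<in>B i. incidence_sign j S) =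
      (\<Sum>S\<in>U. of_bool (i \<in> S) * incidence_sign j S) - (if i = j then 128 else 0)"
    if "i \<in> ?V" "j \<in> ?V" for i j
  proof -
    \<comment> \<open>Members of \<open>U\<close> avoiding \<open>i\<close> already lie in the power
      set, so this form of the union is disjoint.\<close>
    have eq: "B i = Pow (?V - {i}) \<union> {S \<in> U. i \<in> S}" using U_sub by (auto simp: B_def)
    have "(\<Sum>S\<in>B i. incidence_sign j S) =
        (\<Sum>S\<in>Pow (?V - {i}). incidence_sign j S) + (\<Sum>S\<in>{S \<in> U. i \<in> S}. incidence_sign j S)"
      unfolding eq by (rule sum.union_disjoint) (use finU in auto)
    \<comment> \<open>For \<open>i \<noteq> j\<close> the power set is balanced at \<open>j\<close>;
      for \<open>i = j\<close> all of its 128 members avoid \<open>j\<close>.\<close>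
    also have "(\<Sum>S\<in>Pow (?V - {i}). incidence_sign j S) = - (if i = j then 128 else 0)"
    proof (cases "i = j")
      case True
      have "(\<Sum>S\<in>Pow (?V - {i}). incidence_sign j S) = (\<Sum>S\<in>Pow (?V - {i}). - 1)"
        using True by (intro sum.cong) (auto simp: incidence_sign_def)
      also have "\<dots> = - 128" using that(1) by (simp add: card_Pow card_Diff_subset)
      finally show ?thesis using True by simp
    qed (use that in \<open>simp add: sum_incidence_sign_Pow\<close>)
    also have "(\<Sum>S\<in>{S \<in> U. i \<in> S}. incidence_sign j S) = (\<Sum>S\<in>U. of_bool (i \<in> S) * incidence_sign j S)"
      unfolding sum.inter_filter[OF finU] by (intro sum.cong) auto
    finally show ?thesis by simp
  qed
  have mult_V: "sum multiplicity ?V = 78"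
  proof -
    have "?V = {1, 2, 3, 4, 5, 6, 7, 8}" by auto
    then show ?thesis by (simp add: multiplicity_def)
  qed
  show ?thesis
  proof (rule not_frankl_complete_layersI[where V = ?V and X = extras and U = U and L = "\<lambda>x. B (x div 10)"])
    show "extras - {x} \<noteq> {}" for x
    proof -
      have "10 \<in> extras" "11 \<in> extras" by (auto simp: extras_def)
      then show ?thesis by (cases "x = 10") auto
    qed
    show "?A \<subseteq> U" by (auto simp: U_def)
    show "union_closed U" using U_union U_sub by (auto simp: union_closed_def)
    have "S \<union> T \<in> B i" if "S \<in> B i" "T \<in> B i" for S T i
      using that U_union[of S T] U_union[of T S] U_sub by (auto simp: B_def Un_commute)
    then show "union_closed (B (x div 10))" for x by (simp add: union_closed_def)
    show "S \<union> T \<in> B (x div 10)" if "S \<in> U" "T \<in> B (x div 10)" for S T x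
      using that U_union[of S T] U_sub by (auto simp: B_def)
    show "(\<Sum>S\<in>U. incidence_sign j S) + (\<Sum>x\<in>extras. \<Sum>S\<in>B (x div 10). incidence_sign j S) < 0"
      if "j \<in> \<Union>?A" for j
    proof -
      from that have j: "j \<in> ?V" by auto
      have "(\<Sum>x\<in>extras. \<Sum>S\<in>B (x div 10). incidence_sign j S)
          = (\<Sum>i\<in>?V. multiplicity i * (\<Sum>S\<in>B i. incidence_sign j S))"
        by (rule sum_extras)
      also have "\<dots> = (\<Sum>i\<in>?V. (\<Sum>S\<in>U. multiplicity i * of_bool (i \<in> S) * incidence_sign j S)
          - (if i = j then 128 * multiplicity j else 0))"
      proof (rule sum.cong[OF refl])
        fix i assume i: "i \<in> ?V"
        show "multiplicity i * (\<Sum>S\<in>B i. incidence_sign j S) =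
            (\<Sum>S\<in>U. multiplicity i * of_bool (i \<in> S) * incidence_sign j S)
            - (if i = j then 128 * multiplicity j else 0)"
          unfolding sum_B[OF i j] by (simp add: right_diff_distrib sum_distrib_left mult.assoc)
      qed
      also have "\<dots> = (\<Sum>i\<in>?V. \<Sum>S\<in>U. multiplicity i * of_bool (i \<in> S) * incidence_sign j S)
          - 128 * multiplicity j"
        unfolding sum_subtractf using j by simp
      also have "(\<Sum>i\<in>?V. \<Sum>S\<in>U. multiplicity i * of_bool (i \<in> S) * incidence_sign j S)
          = (\<Sum>S\<in>U. (\<Sum>i\<in>?V. multiplicity i * of_bool (i \<in> S)) * incidence_sign j S)"
        unfolding sum_distrib_right by (rule sum.swap)
      finally have "(\<Sum>S\<in>U. incidence_sign j S) + (\<Sum>x\<in>extras. \<Sum>S\<in>B (x div 10). incidence_sign j S)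
          = (\<Sum>S\<in>U. incidence_sign j S * (1 + (\<Sum>i\<in>?V. multiplicity i * of_bool (i \<in> S))))
            - 128 * multiplicity j"
        by (simp add: algebra_simps sum.distrib del: One_nat_def)
      \<comment> \<open>Passing to complements negates the sign and replaces the weight of
        \<open>S\<close> by 78 minus that of \<open>E\<close>; the summand 1 is the copy of
        \<open>S\<close> in \<open>U\<close> itself.\<close>
      also have "(\<Sum>S\<in>U. incidence_sign j S * (1 + (\<Sum>i\<in>?V. multiplicity i * of_bool (i \<in> S))))
          = (\<Sum>E\<in>small_complements. - incidence_sign j E * (79 - sum multiplicity E))"
        unfolding sum_U
      proof (rule sum.cong[OF refl])
        fix E assume "E \<in> small_complements"
        then have E: "E \<subseteq> ?V" by (simp add: small_complements_def)
        have "(\<Sum>i\<in>?V. multiplicity i * of_bool (i \<in> ?V - E)) = (\<Sum>i\<in>?V - E. multiplicity i)"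
          by (intro sum.mono_neutral_cong_right) auto
        also have "\<dots> = 78 - sum multiplicity E"
          using E mult_V by (simp add: sum_diff)
        finally show "incidence_sign j (?V - E) * (1 + (\<Sum>i\<in>?V. multiplicity i * of_bool (i \<in> ?V - E)))
            = - incidence_sign j E * (79 - sum multiplicity E)"
          using j by (simp add: incidence_sign_def)
      qed
      finally show ?thesis using weighted_signs_negative[OF j] by simp
    qed
  qed (use U_sub in \<open>auto simp: extras_def B_def\<close>)
qed

lemma card_25_six_sets:
  "card {S. S \<subseteq> {1..8::nat} \<and> card S = 6 \<and> {1..8} - S \<notin> matching} = 25"
proof -
  let ?V = "{1..8::nat}"
  have matching_sub: "E \<subseteq> ?V" if "E \<in> matching" for E
    using that by (auto simp: matching_def)
  have "{S. S \<subseteq> ?V \<and> card S = 6 \<and> ?V - S \<notin> matching}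
      = {S. S \<subseteq> ?V \<and> card S = 6} - (\<lambda>E. ?V - E) ` matching"
    using matching_sub by (auto simp: double_diff)
  moreover have "card ((\<lambda>E. ?V - E) ` matching) = 3"
  proof -
    have "card ((\<lambda>E. ?V - E) ` matching) = card matching"
      by (intro card_image inj_on_inverseI[where g = "\<lambda>E. ?V - E"]) (auto simp: matching_def)
    then show ?thesis by (simp add: matching_def doubleton_eq_iff)
  qed
  moreover have "(\<lambda>E. ?V - E) ` matching \<subseteq> {S. S \<subseteq> ?V \<and> card S = 6}"
    by (auto simp: matching_def card_Diff_subset)
  moreover have "card {S. S \<subseteq> ?V \<and> card S = 6} = 28"
    by (simp add: n_subsets eval_nat_numeral)
  ultimately show ?thesis by (simp add: card_Diff_subset matching_def)
qed

theorem theorem2p5: "FC 6 8 = Some 26"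
proof -
  have threshold: "FC_threshold 6 8 26"
    using frankl_complete_26_six_sets by (simp add: FC_threshold_def)
  have "(LEAST m. FC_threshold 6 8 m) = 26"
  proof (rule Least_equality)
    show "FC_threshold 6 8 26" by (rule threshold)
  next
    fix m assume m: "FC_threshold 6 8 m"
    let ?A = "{S. S \<subseteq> {1..8::nat} \<and> card S = 6 \<and> {1..8} - S \<notin> matching}"
    have "{S \<in> ?A. card S = 6} = ?A" by auto
    then have "card {S \<in> ?A. card S = 6} = 25" using card_25_six_sets by simp
    moreover have "?A \<subseteq> Pow {1..8}" by auto
    \<comment> \<open>For \<open>m \<le> 25\<close> the family of 25 six-sets meets the threshold
      without being Frankl-complete.\<close>
    ultimately have "m \<le> 25 \<Longrightarrow> ?A \<subseteq> Pow {1..8} \<and> m \<le> card {S \<in> ?A. card S = 6}"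
      by simp
    then have "m \<le> 25 \<Longrightarrow> frankl_complete ?A"
      by (rule m[unfolded FC_threshold_def, THEN spec, THEN mp])
    then show "26 \<le> m" using not_frankl_complete_25 by linarith
  qed
  \<comment> \<open>The value of \<open>FC\<close> is defined here because the family of all 28
    six-sets falls under the bound 26.\<close>
  moreover have "frankl_complete {S. S \<subseteq> {1..8} \<and> card S = 6}"
  proof (rule frankl_complete_26_six_sets)
    have "card {S. S \<subseteq> {1..8::nat} \<and> card S = 6} = 28"
      by (simp add: n_subsets eval_nat_numeral)
    then show "26 \<le> card {S \<in> {S. S \<subseteq> {1..8::nat} \<and> card S = 6}. card S = 6}" by simp
  qed auto
  ultimately show ?thesis by (simp add: FC_def)
qed

end
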